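(* Let $A$ be a unital complex $\mathrm{C}^*$-algebra or a real von Neumann algebra. Then every convex body in $A$ has the strong Mankiewicz property.
   Context: $A$ is regarded as a real Banach space. A convex subset $K$ of a normed space $X$ is a convex body if it has non-empty interior in $X$. A convex subset $K$ of a normed space has the strong Mankiewicz property if for every real normed space $Y$, every convex subset $L\subset Y$, and every surjective isometry (distance-preserving map) $T\colon K\to L$, the map $T$ is affine, i.e. $T(tx+(1-t)y)=tT(x)+(1-t)T(y)$ for all $x,y\in K$, $t\in[0,1]$. A real $\mathrm{C}^*$-algebra is the real part $A=\{a\in A_{\mathbb C}:\mathcal J(a)=a\}$ of a complex $\mathrm{C}^*$-algebra $A_{\mathbb C}$ with respect to a conjugate-linear $*$-automorphism $\mathcal J$ of $A_{\mathbb C}$ with $\mathcal J^2=\mathrm{id}$; it is a real von Neumann algebra if $A_{\mathbb C}$ is a von Neumann algebra. *)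

theory Defs
  imports "HOL-Analysis.Analysis"
begin

class complex_normed_vector = real_normed_vector +
  fixes scaleC :: "complex \<Rightarrow> 'a \<Rightarrow> 'a"  (infixr "*\<^sub>C" 75)
  assumes scaleC_add_right: "c *\<^sub>C (x + y) = c *\<^sub>C x + c *\<^sub>C y"
    and scaleC_add_left: "(c + d) *\<^sub>C x = c *\<^sub>C x + d *\<^sub>C x"
    and scaleC_scaleC: "c *\<^sub>C (d *\<^sub>C x) = (c * d) *\<^sub>C x"
    and scaleC_of_real: "complex_of_real r *\<^sub>C x = r *\<^sub>R x"
    and norm_scaleC: "norm (c *\<^sub>C x) = cmod c * norm x"

text \<open>The inner product is conjugate-linear in the first argument.\<close>

class complex_hilbert_space = complex_normed_vector + banach +
  fixes cinner :: "'a \<Rightarrow> 'a \<Rightarrow> complex"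
  assumes cinner_commute: "cinner x y = cnj (cinner y x)"
    and cinner_add_right: "cinner x (y + z) = cinner x y + cinner x z"
    and cinner_scaleC_right: "cinner x (c *\<^sub>C y) = c * cinner x y"
    and cinner_self: "cinner x x = complex_of_real ((norm x)\<^sup>2)"

text \<open>The unit comes from \<^class>\<open>monoid_mult\<close> rather than \<^class>\<open>ring_1\<close>, so the
  zero algebra (with \<open>0 = 1\<close>) is included.\<close>

class unital_cstar_algebra =
  complex_normed_vector + real_normed_algebra + banach + monoid_mult +
  fixes star :: "'a \<Rightarrow> 'a"
  assumes scaleC_mult_left: "(c *\<^sub>C x) * y = c *\<^sub>C (x * y)"
    and scaleC_mult_right: "x * (c *\<^sub>C y) = c *\<^sub>C (x * y)"
    and star_add: "star (x + y) = star x + star y"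
    and star_scaleC: "star (c *\<^sub>C x) = cnj c *\<^sub>C star x"
    and star_mult: "star (x * y) = star y * star x"
    and star_star: "star (star x) = x"
    and cstar_identity: "norm (star x * x) = (norm x)\<^sup>2"

text \<open>The type \<^typ>\<open>'h \<Rightarrow>\<^sub>L 'h\<close> consists of the bounded real-linear operators; complex
  linearity of each \<open>\<pi> a\<close> is therefore required separately. The operator norm is the same.\<close>

definition unital_star_representation ::
    "('a::unital_cstar_algebra \<Rightarrow> ('h::complex_hilbert_space \<Rightarrow>\<^sub>L 'h)) \<Rightarrow> bool" where
  "unital_star_representation \<pi> \<longleftrightarrow>
     (\<forall>a c \<xi>. \<pi> a (c *\<^sub>C \<xi>) = c *\<^sub>C \<pi> a \<xi>) \<and>
     (\<forall>a b. \<pi> (a + b) = \<pi> a + \<pi> b) \<and>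
     (\<forall>c a \<xi>. \<pi> (c *\<^sub>C a) \<xi> = c *\<^sub>C \<pi> a \<xi>) \<and>
     (\<forall>a b. \<pi> (a * b) = \<pi> a o\<^sub>L \<pi> b) \<and>
     \<pi> 1 = id_blinfun \<and>
     (\<forall>a \<xi> \<eta>. cinner (\<pi> (star a) \<xi>) \<eta> = cinner \<xi> (\<pi> a \<eta>))"

text \<open>The C*-algebra \<^typ>\<open>'a\<close> is a von Neumann algebra, acting on the Hilbert space \<^typ>\<open>'h\<close>:
  it is *-isomorphic to a strongly closed *-subalgebra of the bounded operators on \<^typ>\<open>'h\<close>
  containing the identity operator. (The range of a unital *-representation is automatically a
  *-subalgebra containing the identity.) The space \<^typ>\<open>'h\<close> cannot be quantified inside a
  definition, hence the type argument.\<close>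

definition von_neumann_algebra ::
    "'h::complex_hilbert_space itself \<Rightarrow> 'a::unital_cstar_algebra itself \<Rightarrow> bool" where
  "von_neumann_algebra H A \<longleftrightarrow>
     (\<exists>\<pi> :: 'a \<Rightarrow> ('h \<Rightarrow>\<^sub>L 'h). unital_star_representation \<pi> \<and> inj \<pi> \<and>
        closedin strong_operator_topology (range \<pi>))"

definition conj_linear_star_automorphism :: "('a::unital_cstar_algebra \<Rightarrow> 'a) \<Rightarrow> bool" where
  "conj_linear_star_automorphism J \<longleftrightarrow> bij J \<and>
     (\<forall>x y. J (x + y) = J x + J y) \<and>
     (\<forall>c x. J (c *\<^sub>C x) = cnj c *\<^sub>C J x) \<and>
     (\<forall>x y. J (x * y) = J x * J y) \<and>
     (\<forall>x. J (star x) = star (J x))"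

text \<open>The ambient type \<^typ>\<open>'a\<close> plays the role of the complex algebra of which \<open>A\<close> is the
  real part.\<close>

definition real_cstar_algebra :: "'a::unital_cstar_algebra set \<Rightarrow> bool" where
  "real_cstar_algebra A \<longleftrightarrow>
     (\<exists>J. conj_linear_star_automorphism J \<and> J \<circ> J = id \<and> A = {a. J a = a})"

definition real_von_neumann_algebra ::
    "'h::complex_hilbert_space itself \<Rightarrow> 'a::unital_cstar_algebra set \<Rightarrow> bool" where
  "real_von_neumann_algebra H A \<longleftrightarrow>
     von_neumann_algebra H TYPE('a) \<and> real_cstar_algebra A"

text \<open>The normed space is a subspace \<open>X\<close> of the ambient type, and interiors are taken
  relative to \<open>X\<close>.\<close>

definition convex_body_in :: "'a::real_normed_vector set \<Rightarrow> 'a set \<Rightarrow> bool" where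
  "convex_body_in X K \<longleftrightarrow> K \<subseteq> X \<and> convex K \<and> top_of_set X interior_of K \<noteq> {}"

text \<open>The target space \<^typ>\<open>'y\<close> cannot be quantified inside a definition either; a theorem
  whose conclusion has an unconstrained \<^typ>\<open>'y\<close> covers all real normed spaces.\<close>

definition strong_mankiewicz_property ::
    "'y::real_normed_vector itself \<Rightarrow> 'x::real_normed_vector set \<Rightarrow> bool" where
  "strong_mankiewicz_property Y K \<longleftrightarrow>
     (\<forall>(L :: 'y set) T. convex L \<longrightarrow> T ` K = L \<longrightarrow>
        (\<forall>x\<in>K. \<forall>y\<in>K. dist (T x) (T y) = dist x y) \<longrightarrow>
        (\<forall>x\<in>K. \<forall>y\<in>K. \<forall>t\<in>{0..1}.
           T (t *\<^sub>R x + (1 - t) *\<^sub>R y) = t *\<^sub>R T x + (1 - t) *\<^sub>R T y))"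

end

theory Submission
  imports Defs
begin

text \<open>The engine of the proof is the extreme points of the unit ball. If \<open>u\<close> is extreme, then \<open>x\<close> is
the only point within distance \<open>h\<close> of both \<open>x - h u\<close> and \<open>x + h u\<close>. The midpoint of the images of
these two points under an isometry \<open>T\<close> lies in the convex set \<open>T ` K\<close>, and its preimage has
distance at most \<open>h\<close> from both of them, so it is \<open>x\<close>: a surjective isometry onto a convex set is
affine along every extreme direction (\<open>isometry_midpoint\<close>).

To get from extreme directions to all directions, assume that the closed convex hull of the
extreme points contains a ball (locale \<open>extreme_directions\<close>), and let \<open>0\<close> be an interior point of
\<open>K\<close> with \<open>T 0 = 0\<close>. The slope of \<open>T\<close> in an extreme direction depends on the base point in a
Lipschitz way, because it can be computed from a segment of fixed length. Hence \<open>T\<close> agrees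
to second order with an affine map on the hull of the extreme points (\<open>first_order_hull\<close>).
Applied to the preimages of \<open>\<theta> y\<close> for \<open>\<theta> \<rightarrow> 0\<close>, which all lie over the segment from \<open>0\<close> to a given
\<open>y \<in> T ` K\<close>, this shows that \<open>y\<close> is, up to a controlled factor, in the closed convex hull of the
slopes. Conversely a multiple of that symmetric hull lies in \<open>T ` K\<close>. So \<open>T ` K\<close> is closed under
small combinations \<open>y1 + y2 - y3\<close>, in particular under reflections at midpoints, and the
reflection argument for the Mazur-Ulam theorem (\<open>isometry_fixes_center\<close>) works near \<open>0\<close>. This
makes \<open>T\<close> locally midpoint-affine in the interior of \<open>K\<close>, and a maximum principle along segments makes
it affine (\<open>strong_mankiewicz\<close>).

It remains to supply extreme points. In a C*-algebra all unitaries are extreme, because \<open>1\<close> is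
extreme in the unit ball of any unital Banach algebra (\<open>one_extreme_in_unit_ball\<close>). A
skew-adjoint \<open>k\<close> of norm less than \<open>1\<close> is the skew part of the unitary \<open>k + sqrt (1 + k\<^sup>2)\<close>
(\<open>skew_eq_unitary_difference\<close>). In a complex algebra multiplication by \<open>\<i>\<close> turns this into the
same statement for self-adjoint elements, and so a ball is in the convex hull of the unitaries
(\<open>extreme_directions_complex\<close>).

In the real part of a von Neumann algebra there is no \<open>\<i>\<close>, and self-adjoint elements are reached
through projections. For a self-adjoint contraction \<open>h\<close> there is a symmetry \<open>e\<close>, the sign of \<open>h\<close>,
such that \<open>2 h - e\<close> is again a contraction; iterating gives a binary expansion of \<open>h\<close> in
symmetries (\<open>self_adjoint_near_hull\<close>). The projection \<open>(1 + e) / 2\<close> is the limit of an increasing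
sequence of polynomials in \<open>h\<close> (\<open>ex_spectral_projection\<close>). It exists because the algebra is strongly
closed, and it is in the real part because a conjugate-linear *-automorphism preserves the
order, hence the suprema of increasing sequences (\<open>J_fixes_monotone_limit\<close>).\<close>

section \<open>Midpoints on segments and in symmetric sets\<close>

text \<open>A maximum principle: subtract the affine interpolation of the end points and look at the first
point where the norm of the difference is maximal. To the left of it the norm is strictly smaller
and to the right it is not larger, which contradicts the midpoint identity there unless the
difference vanishes identically.\<close>

lemma locally_midpoint_affine_imp_affine:
  fixes f :: "real \<Rightarrow> 'b::real_normed_vector"
  assumes cont: "continuous_on {0..1} f"
    and mid: "\<And>t. 0 < t \<Longrightarrow> t < 1 \<Longrightarrow>
      \<exists>\<delta>>0. \<forall>h. 0 < h \<and> h < \<delta> \<longrightarrow> f (t - h) + f (t + h) = 2 *\<^sub>R f t"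
    and t: "t \<in> {0..1}"
  shows "f t = (1 - t) *\<^sub>R f 0 + t *\<^sub>R f 1"
proof -
  define g where "g = (\<lambda>s. f s - ((1 - s) *\<^sub>R f 0 + s *\<^sub>R f 1))"
  have gcont: "continuous_on {0..1} (\<lambda>s. norm (g s))"
    unfolding g_def by (intro continuous_intros cont)
  obtain s0 where s0: "s0 \<in> {0..1}" and max: "\<And>s. s \<in> {0..1} \<Longrightarrow> norm (g s) \<le> norm (g s0)"
    using continuous_attains_sup[OF _ _ gcont] by auto
  define M where "M = norm (g s0)"
  define Z where "Z = {s \<in> {0..1}. norm (g s) = M}"
  have "closed Z"
    unfolding Z_def by (rule continuous_closed_preimage_constant[OF gcont]) simp
  moreover have "Z \<noteq> {}" "bdd_below Z"
    using s0 by (auto simp: Z_def M_def intro!: bdd_belowI[of _ 0])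
  ultimately have Inf: "Inf Z \<in> Z"
    by (simp add: closed_contains_Inf)
  define t0 where "t0 = Inf Z"
  have t0: "t0 \<in> {0..1}" "norm (g t0) = M"
    using Inf by (auto simp: t0_def Z_def)
  have below: "norm (g s) < M" if "0 \<le> s" "s < t0" for s
  proof -
    have "s \<notin> Z"
      using that \<open>bdd_below Z\<close> cInf_lower[of s Z] by (auto simp: t0_def)
    moreover have "s \<in> {0..1}" using that t0 by auto
    ultimately show ?thesis using max[of s] by (auto simp: Z_def M_def)
  qed
  have "M = 0"
  proof (rule ccontr)
    assume "M \<noteq> 0"
    have ends: "g 0 = 0" "g 1 = 0" by (simp_all add: g_def)
    have t01: "0 < t0" "t0 < 1"
      using t0 ends \<open>M \<noteq> 0\<close> by (force simp: less_le)+
    obtain \<delta> where d: "\<delta> > 0" "\<And>h. 0 < h \<Longrightarrow> h < \<delta> \<Longrightarrow> f (t0 - h) + f (t0 + h) = 2 *\<^sub>R f t0"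
      using mid[OF t01] by blast
    define h where "h = min (\<delta> / 2) (min t0 (1 - t0))"
    have h: "0 < h" "h < \<delta>" "h \<le> t0" "h \<le> 1 - t0"
      using d t01 by (auto simp: h_def)
    define l where "l = (\<lambda>s. (1 - s) *\<^sub>R f 0 + s *\<^sub>R f 1)"
    have "l (t0 - h) + l (t0 + h) =
        ((1 - (t0 - h)) + (1 - (t0 + h))) *\<^sub>R f 0 + ((t0 - h) + (t0 + h)) *\<^sub>R f 1"
      unfolding l_def scaleR_add_left by simp
    also have "\<dots> = 2 *\<^sub>R l t0"
      by (simp add: l_def scaleR_add_right)
    finally have l: "l (t0 - h) + l (t0 + h) = 2 *\<^sub>R l t0" .
    have gl: "g s = f s - l s" for s by (simp add: g_def l_def)
    have "g (t0 - h) + g (t0 + h) = (f (t0 - h) + f (t0 + h)) - (l (t0 - h) + l (t0 + h))"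
      by (simp add: gl)
    also have "\<dots> = 2 *\<^sub>R g t0"
      by (simp only: d(2)[OF h(1,2)] l gl scaleR_diff_right)
    finally have "2 * M \<le> norm (g (t0 - h)) + norm (g (t0 + h))"
      using t0(2) norm_triangle_ineq[of "g (t0 - h)" "g (t0 + h)"] by simp
    moreover have "norm (g (t0 - h)) < M" using below[of "t0 - h"] h by simp
    moreover have "norm (g (t0 + h)) \<le> M" using max[of "t0 + h"] h t01 by (simp add: M_def)
    ultimately show False by simp
  qed
  then have "g t = 0" using max[OF t] by (simp add: M_def)
  then show ?thesis by (simp add: g_def)
qed

text \<open>The reflection trick from Vaisala's proof of the Mazur-Ulam theorem: if \<open>R\<close> is the reflection at
\<open>m\<close>, then \<open>R inv g R g\<close> moves \<open>m\<close> exactly twice as far as \<open>g\<close> does, whereas in a bounded set the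
displacement is bounded independently of the isometry.\<close>

lemma isometry_fixes_center:
  fixes m :: "'b::real_normed_vector"
  assumes bdd: "bounded H" and m: "m \<in> H"
    and refl: "\<And>x. x \<in> H \<Longrightarrow> 2 *\<^sub>R m - x \<in> H"
    and g: "bij_betw g H H" "\<And>x y. x \<in> H \<Longrightarrow> y \<in> H \<Longrightarrow> dist (g x) (g y) = dist x y"
  shows "g m = m"
proof -
  define R where "R = (\<lambda>x. 2 *\<^sub>R m - x)"
  have R: "R x \<in> H" "R (R x) = x" "dist (R x) (R y) = dist x y" if "x \<in> H" for x y
    using refl that by (auto simp: R_def dist_norm norm_minus_commute)
  have bijR: "bij_betw R H H"
    by (rule bij_betw_byWitness[of _ R]) (use R in auto)
  obtain D where D: "\<And>x. x \<in> H \<Longrightarrow> dist x m \<le> D"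
    using bdd bounded_any_center by (metis dist_commute)
  have grow: "2 ^ n * dist (g m) m \<le> D"
    if "bij_betw g H H" "\<And>x y. x \<in> H \<Longrightarrow> y \<in> H \<Longrightarrow> dist (g x) (g y) = dist x y" for n g
    using that
  proof (induction n arbitrary: g)
    case 0
    then show ?case using D[of "g m"] m bij_betwE by fastforce
  next
    case (Suc n)
    define g' where "g' = inv_into H g"
    have g': "bij_betw g' H H" "\<And>x. x \<in> H \<Longrightarrow> g' x \<in> H"
      using Suc.prems(1) bij_betw_inv_into bij_betwE unfolding g'_def by blast+
    have gg': "g (g' x) = x" if "x \<in> H" for x
      using Suc.prems(1) that unfolding g'_def by (rule bij_betw_inv_into_right)
    have g'g: "g' (g x) = x" if "x \<in> H" for x
      using Suc.prems(1) that unfolding g'_def by (rule bij_betw_inv_into_left)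
    have gH: "g x \<in> H" if "x \<in> H" for x using Suc.prems(1) that bij_betwE by blast
    have isog': "dist (g' x) (g' y) = dist x y" if "x \<in> H" "y \<in> H" for x y
      using Suc.prems(2)[of "g' x" "g' y"] that by (simp add: g' gg')
    define k where "k = R \<circ> g' \<circ> R \<circ> g"
    have "2 ^ n * dist (k m) m \<le> D"
    proof (rule Suc.IH)
      show "bij_betw k H H"
        using bij_betw_trans[OF bij_betw_trans[OF bij_betw_trans[OF Suc.prems(1) bijR] g'(1)] bijR]
        by (simp add: k_def comp_assoc)
      show "dist (k x) (k y) = dist x y" if "x \<in> H" "y \<in> H" for x y
        using that by (simp add: k_def R gH g' isog' Suc.prems(2))
    qed
    moreover have "dist (k m) m = 2 * dist (g m) m"
    proof -
      have "dist (k m) m = dist (R (k m)) (R m)"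
        using R(3)[of "k m" m] m by (simp add: k_def R gH g')
      also have "\<dots> = dist (g' (R (g m))) m"
        using m by (simp add: k_def R gH g') (simp add: R_def scaleR_2)
      also have "\<dots> = dist (g' (R (g m))) (g' (g m))" using g'g m by simp
      also have "\<dots> = dist (R (g m)) (g m)" by (rule isog') (use R gH m in auto)
      also have "\<dots> = norm (2 *\<^sub>R (m - g m))"
        by (simp add: R_def dist_norm algebra_simps scaleR_2)
      finally show ?thesis by (simp add: dist_norm norm_minus_commute)
    qed
    ultimately show ?case by simp
  qed
  have "dist (g m) m \<le> 0"
  proof (rule ccontr)
    assume neg: "\<not> dist (g m) m \<le> 0"
    obtain n where "D / dist (g m) m < 2 ^ n"
      using real_arch_pow[of 2] by auto
    then show False using grow[OF g, of n] neg
      by (simp add: field_simps)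
  qed
  then show ?thesis by simp
qed

section \<open>Isometries along extreme directions\<close>

text \<open>\<open>E\<close> is a symmetric set of extreme points of the unit ball of the Banach space \<open>X\<close>. Extremality is
stated as uniqueness of metric midpoints, which is the form in which it acts on isometries. All
is relative to a subspace \<open>X\<close> of the ambient type so that the real part of an algebra fits.\<close>

locale extreme_directions =
  fixes X E :: "'a::real_normed_vector set" and r :: real
  assumes subX: "subspace X" and complX: "complete X"
    and EX: "E \<subseteq> X" and uminus_E: "\<And>u. u \<in> E \<Longrightarrow> - u \<in> E"
    and norm_E: "\<And>u. u \<in> E \<Longrightarrow> norm u \<le> 1"
    and extreme: "\<And>u d. u \<in> E \<Longrightarrow> d \<in> X \<Longrightarrow> norm (u + d) \<le> 1 \<Longrightarrow> norm (u - d) \<le> 1 \<Longrightarrow> d = 0"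
    and rpos: "0 < r"
    and ball_hull: "\<And>x. x \<in> X \<Longrightarrow> norm x \<le> r \<Longrightarrow> x \<in> closure (convex hull E)"

text \<open>The midpoint of the two images is attained by \<open>T\<close> at a point \<open>z\<close>, because the image is convex. As
\<open>T\<close> preserves distances, \<open>z\<close> is within \<open>h\<close> of both \<open>x - h u\<close> and \<open>x + h u\<close>, and extremality of \<open>u\<close>
leaves only \<open>z = x\<close>.\<close>

lemma (in extreme_directions) isometry_midpoint:
  fixes T :: "'a \<Rightarrow> 'y::real_normed_vector"
  assumes KX: "K \<subseteq> X" and conv: "convex (T ` K)"
    and iso: "\<And>x y. x \<in> K \<Longrightarrow> y \<in> K \<Longrightarrow> dist (T x) (T y) = dist x y"
    and u: "u \<in> E" and h: "0 \<le> h" and K: "x - h *\<^sub>R u \<in> K" "x + h *\<^sub>R u \<in> K"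
  shows "T (x - h *\<^sub>R u) + T (x + h *\<^sub>R u) = 2 *\<^sub>R T x"
proof (cases "h = 0")
  case True then show ?thesis by (simp add: scaleR_2)
next
  case False
  then have h: "h > 0" using h by simp
  let ?p = "x - h *\<^sub>R u" and ?q = "x + h *\<^sub>R u"
  have "(1/2) *\<^sub>R T ?p + (1/2) *\<^sub>R T ?q \<in> T ` K"
    by (rule convexD[OF conv]) (use K in auto)
  then obtain z where z: "z \<in> K" "T z = (1/2) *\<^sub>R T ?p + (1/2) *\<^sub>R T ?q" by auto
  have pq: "norm (T ?p - T ?q) \<le> 2 * h"
  proof -
    have "?p - ?q = - ((2 * h) *\<^sub>R u)"
      by (simp add: scaleR_2 flip: scaleR_scaleR)
    then have "norm (T ?p - T ?q) = norm ((2 * h) *\<^sub>R u)"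
      using iso[OF K] by (simp only: dist_norm norm_minus_cancel)
    also have "\<dots> \<le> 2 * h" using h norm_E[OF u] by simp
    finally show ?thesis .
  qed
  have "T z - T ?p = (1/2) *\<^sub>R (T ?q - T ?p)" "T z - T ?q = (1/2) *\<^sub>R (T ?p - T ?q)"
    using scaleR_half_double[of "T ?p"] scaleR_half_double[of "T ?q"]
    by (simp_all add: z(2) algebra_simps)
  then have d: "norm (z - ?p) \<le> h" "norm (z - ?q) \<le> h"
    using iso[OF z(1) K(1)] iso[OF z(1) K(2)] pq
    by (simp_all add: dist_norm norm_minus_commute)
  define d where "d = (1 / h) *\<^sub>R (z - x)"
  have xX: "x \<in> X"
  proof -
    have "(1/2) *\<^sub>R (?p + ?q) \<in> X"
      using K KX by (blast intro: subspace_scale subspace_add subX)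
    moreover have "?p + ?q = x + x" by simp
    ultimately show ?thesis using scaleR_half_double[of x] by simp
  qed
  have eqs: "u + d = (1 / h) *\<^sub>R (z - ?p)" "u - d = - ((1 / h) *\<^sub>R (z - ?q))"
    using h by (simp_all add: d_def algebra_simps)
  have "norm (u + d) = norm (z - ?p) / h" "norm (u - d) = norm (z - ?q) / h"
    unfolding eqs norm_minus_cancel using h by simp_all
  then have "norm (u + d) \<le> 1" "norm (u - d) \<le> 1"
    using d h by simp_all
  moreover have "d \<in> X" unfolding d_def using z(1) KX xX subX
    by (meson subspace_scale subspace_diff subsetD)
  ultimately have "d = 0" using extreme[OF u] by blast
  then have "T x = (1/2) *\<^sub>R T ?p + (1/2) *\<^sub>R T ?q" using h z(2) by (simp add: d_def)
  then have "2 *\<^sub>R T x = 2 *\<^sub>R ((1/2) *\<^sub>R T ?p + (1/2) *\<^sub>R T ?q)" by simp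
  then show ?thesis by (simp add: scaleR_add_right)
qed

section \<open>An isometry near an interior point\<close>

text \<open>The situation at an interior point of a convex body, moved to the origin on both sides.\<close>

locale centered_isometry = extreme_directions X E r
  for X E :: "'a::real_normed_vector set" and r :: real +
  fixes K :: "'a set" and T :: "'a \<Rightarrow> 'y::real_normed_vector" and \<rho> :: real
  assumes KX: "K \<subseteq> X" and convex_image: "convex (T ` K)"
    and iso: "\<And>x y. x \<in> K \<Longrightarrow> y \<in> K \<Longrightarrow> dist (T x) (T y) = dist x y"
    and \<rho>_pos: "0 < \<rho>" and ball_K: "\<And>x. x \<in> X \<Longrightarrow> norm x \<le> \<rho> \<Longrightarrow> x \<in> K"
    and T0: "T 0 = 0"
begin

lemma zero_X: "0 \<in> X"
  using subX by (rule subspace_0)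

lemma zero_K: "0 \<in> K"
  using ball_K zero_X \<rho>_pos by simp

lemma norm_T: "x \<in> K \<Longrightarrow> norm (T x) = norm x"
  using iso[of x 0] zero_K by (simp add: T0 dist_norm)

lemma step_in_K:
  assumes "x \<in> X" "z \<in> X" "norm z \<le> 1" "norm x + \<bar>s\<bar> \<le> \<rho>"
  shows "x + s *\<^sub>R z \<in> K"
proof (rule ball_K)
  show "x + s *\<^sub>R z \<in> X" using assms subX by (blast intro: subspace_add subspace_scale)
  have "norm (x + s *\<^sub>R z) \<le> norm x + \<bar>s\<bar> * norm z"
    using norm_triangle_ineq[of x "s *\<^sub>R z"] by simp
  also have "\<dots> \<le> norm x + \<bar>s\<bar>" using assms(3) by (simp add: mult_left_le)
  finally show "norm (x + s *\<^sub>R z) \<le> \<rho>" using assms(4) by simp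
qed

lemma affine_in_direction:
  assumes u: "u \<in> E" and x: "x \<in> X" and S: "0 < S" "norm x + S \<le> \<rho>" and s: "0 \<le> s" "s \<le> S"
  shows "T (x + s *\<^sub>R u) - T x = (s / S) *\<^sub>R (T (x + S *\<^sub>R u) - T x)"
proof -
  define f where "f = (\<lambda>t. T (x + (t * S) *\<^sub>R u))"
  have inK: "x + (t * S) *\<^sub>R u \<in> K" if "t \<in> {0..1}" for t
  proof -
    have "\<bar>t * S\<bar> \<le> S" using that S by (simp add: abs_mult mult_left_le_one_le)
    then show ?thesis using S u EX norm_E by (intro step_in_K x) auto
  qed
  have "S-lipschitz_on {0..1} f"
  proof (rule lipschitz_onI)
    fix t t' :: real assume tt: "t \<in> {0..1}" "t' \<in> {0..1}"
    have "dist (f t) (f t') = norm ((t * S - t' * S) *\<^sub>R u)"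
      unfolding f_def iso[OF inK[OF tt(1)] inK[OF tt(2)]] by (simp add: dist_norm scaleR_diff_left)
    also have "\<dots> = S * dist t t' * norm u"
      using S by (simp add: dist_norm abs_mult flip: left_diff_distrib)
    also have "\<dots> \<le> S * dist t t'"
      using S norm_E[OF u] by (simp add: mult_left_le)
    finally show "dist (f t) (f t') \<le> S * dist t t'" .
  qed (use S in simp)
  then have cont: "continuous_on {0..1} f" by (rule lipschitz_on_continuous_on)
  have "f (s / S) = (1 - s / S) *\<^sub>R f 0 + (s / S) *\<^sub>R f 1"
  proof (rule locally_midpoint_affine_imp_affine[OF cont])
    fix t :: real assume t: "0 < t" "t < 1"
    have "f (t - h) + f (t + h) = 2 *\<^sub>R f t" if h: "0 < h" "h < min t (1 - t)" for h
    proof -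
      let ?c = "x + (t * S) *\<^sub>R u"
      have eqs: "x + ((t - h) * S) *\<^sub>R u = ?c - (h * S) *\<^sub>R u"
          "x + ((t + h) * S) *\<^sub>R u = ?c + (h * S) *\<^sub>R u"
        by (simp_all add: algebra_simps)
      have "?c - (h * S) *\<^sub>R u \<in> K" "?c + (h * S) *\<^sub>R u \<in> K"
        using inK[of "t - h"] inK[of "t + h"] h t by (simp_all add: eqs)
      then show ?thesis
        unfolding f_def eqs using S h
        by (intro isometry_midpoint[OF KX convex_image iso u]) auto
    qed
    then show "\<exists>\<delta>>0. \<forall>h. 0 < h \<and> h < \<delta> \<longrightarrow> f (t - h) + f (t + h) = 2 *\<^sub>R f t"
      using t by (intro exI[of _ "min t (1 - t)"]) auto
  qed (use s S in auto)
  then have "T (x + s *\<^sub>R u) = (1 - s / S) *\<^sub>R T x + (s / S) *\<^sub>R T (x + S *\<^sub>R u)"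
    using S by (simp add: f_def)
  then show ?thesis by (simp add: algebra_simps)
qed

text \<open>The derivative of \<open>T\<close> at \<open>0\<close> in the extreme direction \<open>u\<close>. The step length \<open>\<rho> / 2\<close> leaves room to
take the same step from any base point of norm at most \<open>\<rho> / 2\<close>.\<close>

definition slope :: "'a \<Rightarrow> 'y" where "slope u = (2 / \<rho>) *\<^sub>R T ((\<rho> / 2) *\<^sub>R u)"

lemma T_scaled_direction:
  assumes "u \<in> E" "0 \<le> s" "s \<le> \<rho> / 2"
  shows "T (s *\<^sub>R u) = s *\<^sub>R slope u"
  using affine_in_direction[of u 0 "\<rho> / 2" s] assms \<rho>_pos zero_X
  by (simp add: T0 slope_def)

lemma slope_minus: "u \<in> E \<Longrightarrow> slope (- u) = - slope u"
proof -
  assume u: "u \<in> E"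
  have K: "(\<rho>/2) *\<^sub>R u \<in> K" "- ((\<rho>/2) *\<^sub>R u) \<in> K"
    using step_in_K[of 0 u "\<rho>/2"] step_in_K[of 0 u "-\<rho>/2"] u EX norm_E zero_X \<rho>_pos by auto
  have "T (- ((\<rho>/2) *\<^sub>R u)) + T ((\<rho>/2) *\<^sub>R u) = 0"
    using isometry_midpoint[OF KX convex_image iso u, of "\<rho>/2" 0] K \<rho>_pos by (simp add: T0)
  then show ?thesis
    by (simp add: slope_def eq_neg_iff_add_eq_0 flip: scaleR_minus_right scaleR_add_right)
qed

text \<open>The slope at \<open>x\<close> and the slope at \<open>0\<close> are difference quotients over the same length \<open>\<rho> / 2\<close>, and an
isometry changes each end point by at most \<open>norm x\<close>.\<close>

lemma first_order_direction:
  assumes u: "u \<in> E" and x: "x \<in> X" and k: "0 \<le> \<kappa>" "norm x + \<kappa> \<le> \<rho> / 2"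
  shows "norm (T (x + \<kappa> *\<^sub>R u) - T x - \<kappa> *\<^sub>R slope u) \<le> 4 / \<rho> * \<kappa> * norm x"
proof -
  let ?a = "\<rho> / 2"
  have K: "x + ?a *\<^sub>R u \<in> K" "?a *\<^sub>R u \<in> K" "x \<in> K"
    using step_in_K[of x u ?a] step_in_K[of 0 u ?a] step_in_K[of x 0 0]
      u x EX norm_E k zero_X \<rho>_pos by auto
  have "T (x + \<kappa> *\<^sub>R u) - T x = (\<kappa> / ?a) *\<^sub>R (T (x + ?a *\<^sub>R u) - T x)"
    using k norm_ge_zero[of x] \<rho>_pos by (intro affine_in_direction u x) linarith+
  then have "T (x + \<kappa> *\<^sub>R u) - T x - \<kappa> *\<^sub>R slope u
      = (\<kappa> / ?a) *\<^sub>R ((T (x + ?a *\<^sub>R u) - T (?a *\<^sub>R u)) - T x)"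
    by (simp add: slope_def algebra_simps)
  also have "norm \<dots> \<le> (\<kappa> / ?a) * (norm (T (x + ?a *\<^sub>R u) - T (?a *\<^sub>R u)) + norm (T x))"
    unfolding norm_scaleR using k \<rho>_pos
    by (simp add: divide_right_mono mult_left_mono norm_triangle_ineq4)
  also have "norm (T (x + ?a *\<^sub>R u) - T (?a *\<^sub>R u)) = norm x"
    using iso[OF K(1,2)] by (simp add: dist_norm)
  also have "(\<kappa> / ?a) * (norm x + norm (T x)) = 4 / \<rho> * \<kappa> * norm x"
    using norm_T[OF K(3)] by simp
  finally show ?thesis .
qed

text \<open>The estimate of \<open>first_order_direction\<close>, required at all base points at once with one constant, is
stable under convex combinations of pairs (direction, slope): the step in the combined direction is
taken as two successive steps. Passing to pairs avoids having to show that the slope extends to a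
linear map.\<close>

lemma first_order_hull:
  assumes "(z, v) \<in> convex hull ((\<lambda>u. (u, slope u)) ` E)"
  shows "z \<in> X" and "norm z \<le> 1"
    and "x \<in> X \<Longrightarrow> 0 \<le> \<kappa> \<Longrightarrow> norm x + \<kappa> \<le> \<rho> / 2 \<Longrightarrow>
      norm (T (x + \<kappa> *\<^sub>R z) - T x - \<kappa> *\<^sub>R v) \<le> 4 / \<rho> * \<kappa> * (norm x + \<kappa>)"
proof -
  define Q where "Q = {(z, v). z \<in> X \<and> norm z \<le> 1 \<and>
    (\<forall>x\<in>X. \<forall>\<kappa>\<ge>0. norm x + \<kappa> \<le> \<rho> / 2 \<longrightarrow>
      norm (T (x + \<kappa> *\<^sub>R z) - T x - \<kappa> *\<^sub>R v) \<le> 4 / \<rho> * \<kappa> * (norm x + \<kappa>))}"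
  have QE: "(u, slope u) \<in> Q" if u: "u \<in> E" for u
  proof -
    have "norm (T (x + \<kappa> *\<^sub>R u) - T x - \<kappa> *\<^sub>R slope u) \<le> 4 / \<rho> * \<kappa> * (norm x + \<kappa>)"
      if "x \<in> X" "0 \<le> \<kappa>" "norm x + \<kappa> \<le> \<rho> / 2" for x \<kappa>
      using first_order_direction[OF u that] that \<rho>_pos
      by (elim order_trans) (intro mult_left_mono; simp)
    then show ?thesis using u EX norm_E by (auto simp: Q_def)
  qed
  have "convex Q"
  proof (rule convexI)
    fix p q :: "'a \<times> 'y" and l m :: real
    assume p: "p \<in> Q" and q: "q \<in> Q" and lm: "0 \<le> l" "0 \<le> m" "l + m = 1"
    obtain z v z' v' where pq: "p = (z, v)" "q = (z', v')" by (cases p, cases q)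
    have zX: "z \<in> X" "z' \<in> X" "norm z \<le> 1" "norm z' \<le> 1"
      using p q by (auto simp: Q_def pq)
    have X': "l *\<^sub>R z + m *\<^sub>R z' \<in> X"
      using zX subX by (blast intro: subspace_add subspace_scale)
    have "norm (l *\<^sub>R z + m *\<^sub>R z') \<le> l * norm z + m * norm z'"
      using norm_triangle_ineq[of "l *\<^sub>R z" "m *\<^sub>R z'"] lm by simp
    also have "\<dots> \<le> l * 1 + m * 1"
      using zX lm by (intro add_mono mult_left_mono) auto
    finally have n1: "norm (l *\<^sub>R z + m *\<^sub>R z') \<le> 1" using lm by simp
    \<comment> \<open>The second step starts at \<open>x'\<close>, where the budget \<open>norm x + \<kappa>\<close> has been partly spent.\<close>
    have "norm (T (x + \<kappa> *\<^sub>R (l *\<^sub>R z + m *\<^sub>R z')) - T x - \<kappa> *\<^sub>R (l *\<^sub>R v + m *\<^sub>R v'))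
        \<le> 4 / \<rho> * \<kappa> * (norm x + \<kappa>)"
      if x: "x \<in> X" and k: "0 \<le> \<kappa>" "norm x + \<kappa> \<le> \<rho> / 2" for x \<kappa>
    proof -
      define x' where "x' = x + (\<kappa> * l) *\<^sub>R z"
      have kl: "0 \<le> \<kappa> * l" "0 \<le> \<kappa> * m" "\<kappa> * l + \<kappa> * m = \<kappa>"
        using k lm by (simp_all flip: distrib_left)
      have x'X: "x' \<in> X" unfolding x'_def using x zX subX by (blast intro: subspace_add subspace_scale)
      have "norm x' \<le> norm x + (\<kappa> * l) * norm z"
        using norm_triangle_ineq[of x "(\<kappa> * l) *\<^sub>R z"] kl k lm by (simp add: x'_def)
      also have "\<dots> \<le> norm x + \<kappa> * l"
        using kl(1) zX(3) by (simp add: mult_left_le)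
      finally have nx': "norm x' \<le> norm x + \<kappa> * l" .
      have kl': "\<kappa> * l \<le> \<kappa>" using kl by linarith
      have "norm (T x' - T x - (\<kappa> * l) *\<^sub>R v) \<le> 4 / \<rho> * (\<kappa> * l) * (norm x + \<kappa> * l)"
        unfolding x'_def using p kl k x by (auto simp: Q_def pq)
      also have "\<dots> \<le> 4 / \<rho> * (\<kappa> * l) * (norm x + \<kappa>)"
        using kl' lm k \<rho>_pos by (intro mult_left_mono mult_nonneg_nonneg) auto
      finally have 1: "norm (T x' - T x - (\<kappa> * l) *\<^sub>R v) \<le> 4 / \<rho> * (\<kappa> * l) * (norm x + \<kappa>)" .
      have "norm (T (x' + (\<kappa> * m) *\<^sub>R z') - T x' - (\<kappa> * m) *\<^sub>R v')
          \<le> 4 / \<rho> * (\<kappa> * m) * (norm x' + \<kappa> * m)"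
        using q kl k x'X nx' by (auto simp: Q_def pq)
      also have "\<dots> \<le> 4 / \<rho> * (\<kappa> * m) * (norm x + \<kappa>)"
        using kl lm k nx' \<rho>_pos by (intro mult_left_mono mult_nonneg_nonneg) auto
      finally have 2: "norm (T (x' + (\<kappa> * m) *\<^sub>R z') - T x' - (\<kappa> * m) *\<^sub>R v')
          \<le> 4 / \<rho> * (\<kappa> * m) * (norm x + \<kappa>)" .
      have "x + \<kappa> *\<^sub>R (l *\<^sub>R z + m *\<^sub>R z') = x' + (\<kappa> * m) *\<^sub>R z'"
        by (simp add: x'_def scaleR_add_right add.assoc)
      then have Tx: "T (x + \<kappa> *\<^sub>R (l *\<^sub>R z + m *\<^sub>R z')) = T (x' + (\<kappa> * m) *\<^sub>R z')" by simp
      have "T (x + \<kappa> *\<^sub>R (l *\<^sub>R z + m *\<^sub>R z')) - T x - \<kappa> *\<^sub>R (l *\<^sub>R v + m *\<^sub>R v') =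
        (T x' - T x - (\<kappa> * l) *\<^sub>R v) + (T (x' + (\<kappa> * m) *\<^sub>R z') - T x' - (\<kappa> * m) *\<^sub>R v')"
        unfolding Tx by (simp add: scaleR_add_right)
      also have "norm \<dots> \<le> 4 / \<rho> * (\<kappa> * l) * (norm x + \<kappa>) + 4 / \<rho> * (\<kappa> * m) * (norm x + \<kappa>)"
        by (rule norm_triangle_le[OF add_mono[OF 1 2]])
      also have "\<dots> = 4 / \<rho> * (\<kappa> * l + \<kappa> * m) * (norm x + \<kappa>)"
        by (simp add: add_divide_distrib ring_distribs)
      finally show ?thesis unfolding kl(3) .
    qed
    then show "l *\<^sub>R p + m *\<^sub>R q \<in> Q"
      using X' n1 by (simp add: Q_def pq)
  qed
  then have "convex hull ((\<lambda>u. (u, slope u)) ` E) \<subseteq> Q"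
    using QE by (intro hull_minimal) auto
  then have "(z, v) \<in> Q" using assms by blast
  then show "z \<in> X" "norm z \<le> 1" "x \<in> X \<Longrightarrow> 0 \<le> \<kappa> \<Longrightarrow> norm x + \<kappa> \<le> \<rho> / 2 \<Longrightarrow>
      norm (T (x + \<kappa> *\<^sub>R z) - T x - \<kappa> *\<^sub>R v) \<le> 4 / \<rho> * \<kappa> * (norm x + \<kappa>)"
    by (auto simp: Q_def)
qed

text \<open>Up to scaling this turns out to be a neighbourhood of \<open>0\<close> in \<open>T ` K\<close>.\<close>

definition slope_hull :: "'y set" where "slope_hull = closure (convex hull (slope ` E))"

lemma convex_slope_hull: "convex slope_hull"
  by (simp add: slope_hull_def convex_closure)

lemma graph_hull_over_hull:
  assumes "z \<in> convex hull E"
  shows "\<exists>v. v \<in> convex hull (slope ` E) \<and> (z, v) \<in> convex hull ((\<lambda>u. (u, slope u)) ` E)"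
proof -
  have "fst ` (convex hull ((\<lambda>u. (u, slope u)) ` E)) = convex hull E"
    by (simp add: convex_hull_linear_image linear_fst image_image)
  then obtain v where v: "(z, v) \<in> convex hull ((\<lambda>u. (u, slope u)) ` E)"
    using assms by force
  have "snd ` (convex hull ((\<lambda>u. (u, slope u)) ` E)) = convex hull (slope ` E)"
    by (simp add: convex_hull_linear_image linear_snd image_image)
  moreover have "v \<in> snd ` (convex hull ((\<lambda>u. (u, slope u)) ` E))" using v by (force simp: image_iff)
  ultimately show ?thesis using v by auto
qed

text \<open>For small \<open>\<theta>\<close> the point \<open>\<theta> y\<close> is the image of some \<open>x\<close> of the same norm. Approximating \<open>x\<close> by a
multiple \<open>\<kappa> z\<close> of a point of the hull of \<open>E\<close>, the image \<open>\<theta> y\<close> is \<open>\<kappa> v\<close>, with \<open>v\<close> in the hull of the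
slopes, up to an error that is quadratic in \<open>\<kappa>\<close>. Rescaling by \<open>1 / \<kappa>\<close> removes the error.\<close>

lemma image_direction_in_slope_hull:
  assumes y: "y \<in> T ` K" "y \<noteq> 0"
  shows "(r / norm y) *\<^sub>R y \<in> slope_hull"
  unfolding slope_hull_def closure_approachable
proof (intro allI impI)
  fix e :: real assume e: "0 < e"
  define \<eta> where "\<eta> = norm y"
  have \<eta>: "\<eta> > 0" using y by (simp add: \<eta>_def)
  \<comment> \<open>The three bounds keep \<open>\<kappa> z\<close> in the ball of validity of the first-order estimate, give
  \<open>\<theta> \<le> 1\<close> and make the quadratic error at most \<open>\<kappa> e / 4\<close>.\<close>
  define \<kappa> where "\<kappa> = min (min (\<rho> / 2) (\<eta> / r)) (e * \<rho> / 16)"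
  have \<kappa>: "0 < \<kappa>" "\<kappa> \<le> \<rho> / 2" "\<kappa> * r \<le> \<eta>" "4 / \<rho> * \<kappa> \<le> e / 4"
  proof -
    show "0 < \<kappa>" using e \<eta> \<rho>_pos rpos by (simp add: \<kappa>_def)
    show "\<kappa> \<le> \<rho> / 2" unfolding \<kappa>_def by linarith
    have "\<kappa> \<le> \<eta> / r" unfolding \<kappa>_def by linarith
    then show "\<kappa> * r \<le> \<eta>" using rpos by (simp add: field_simps)
    have "\<kappa> \<le> e * \<rho> / 16" unfolding \<kappa>_def by linarith
    then show "4 / \<rho> * \<kappa> \<le> e / 4" using \<rho>_pos by (simp add: field_simps)
  qed
  define \<theta> where "\<theta> = \<kappa> * r / \<eta>"
  have \<theta>: "0 < \<theta>" "\<theta> \<le> 1" using \<kappa> \<eta> rpos by (simp_all add: \<theta>_def)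
  have "\<theta> *\<^sub>R y + (1 - \<theta>) *\<^sub>R 0 \<in> T ` K"
    using \<theta> y zero_K T0 by (intro convexD[OF convex_image]) (auto simp: image_iff intro: bexI[of _ 0])
  then obtain x where x: "x \<in> K" "T x = \<theta> *\<^sub>R y" by auto
  have nx: "norm x = \<kappa> * r"
    using norm_T[OF x(1)] \<theta> \<eta> \<kappa> rpos by (simp add: x(2) \<theta>_def \<eta>_def abs_mult)
  have "(1 / \<kappa>) *\<^sub>R x \<in> closure (convex hull E)"
    using x KX subX \<kappa> nx by (intro ball_hull subspace_scale) auto
  then obtain z where z: "z \<in> convex hull E" "dist z ((1 / \<kappa>) *\<^sub>R x) < e / 4"
    using e by (metis closure_approachable zero_less_divide_iff zero_less_numeral)
  obtain v where v: "v \<in> convex hull (slope ` E)" "(z, v) \<in> convex hull ((\<lambda>u. (u, slope u)) ` E)"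
    using graph_hull_over_hull[OF z(1)] by blast
  have "norm (T (\<kappa> *\<^sub>R z) - \<kappa> *\<^sub>R v) \<le> 4 / \<rho> * \<kappa> * \<kappa>"
    using first_order_hull(3)[OF v(2), of 0 \<kappa>] \<kappa> zero_X by (simp add: T0)
  also have "\<dots> \<le> e / 4 * \<kappa>"
    using \<kappa> by (intro mult_right_mono) auto
  finally have 1: "norm (T (\<kappa> *\<^sub>R z) - \<kappa> *\<^sub>R v) \<le> e / 4 * \<kappa>" .
  have "\<kappa> *\<^sub>R z \<in> K"
    using step_in_K[of 0 z \<kappa>] first_order_hull(1,2)[OF v(2)] \<kappa> zero_X \<rho>_pos by simp
  then have "norm (T x - T (\<kappa> *\<^sub>R z)) = norm (\<kappa> *\<^sub>R ((1 / \<kappa>) *\<^sub>R x - z))"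
    using iso[OF x(1), of "\<kappa> *\<^sub>R z"] \<kappa> by (simp add: dist_norm algebra_simps)
  also have "\<dots> = \<kappa> * dist z ((1 / \<kappa>) *\<^sub>R x)"
    using \<kappa> by (simp add: dist_norm norm_minus_commute)
  also have "\<dots> \<le> e / 4 * \<kappa>" using z(2) \<kappa> by simp
  finally have 2: "norm (T x - T (\<kappa> *\<^sub>R z)) \<le> e / 4 * \<kappa>" .
  have "\<theta> = \<kappa> * (r / norm y)" by (simp add: \<theta>_def \<eta>_def)
  then have "\<kappa> *\<^sub>R ((r / norm y) *\<^sub>R y - v) = (T x - T (\<kappa> *\<^sub>R z)) + (T (\<kappa> *\<^sub>R z) - \<kappa> *\<^sub>R v)"
    by (simp add: x(2) scaleR_diff_right)
  then have "norm (\<kappa> *\<^sub>R ((r / norm y) *\<^sub>R y - v)) \<le> e / 4 * \<kappa> + e / 4 * \<kappa>"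
    using norm_triangle_le[OF add_mono[OF 2 1]] by simp
  then have "\<kappa> * norm ((r / norm y) *\<^sub>R y - v) \<le> \<kappa> * (e / 2)" using \<kappa> by simp
  then have "norm ((r / norm y) *\<^sub>R y - v) < e" using \<kappa> e by simp
  then show "\<exists>v\<in>convex hull (slope ` E). dist v ((r / norm y) *\<^sub>R y) < e"
    using v(1) by (auto simp: dist_norm norm_minus_commute)
qed

lemma slope_hull_symmetric:
  assumes "v \<in> slope_hull" shows "- v \<in> slope_hull"
proof -
  have "uminus ` (convex hull (slope ` E)) = convex hull (uminus ` (slope ` E))"
    by (rule convex_hull_linear_image[OF linear_uminus])
  also have "\<dots> \<subseteq> convex hull (slope ` E)"
  proof (intro hull_mono image_subsetI, elim imageE)
    fix v u assume "v = slope u" "u \<in> E"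
    then show "- v \<in> slope ` E" using slope_minus[of u] uminus_E[of u] by (metis imageI)
  qed
  finally have "uminus ` slope_hull \<subseteq> slope_hull"
    unfolding slope_hull_def
    by (intro image_closure_subset closed_closure continuous_on_minus continuous_on_id)
      (rule order_trans[OF _ closure_subset])
  then show ?thesis using assms by blast
qed

text \<open>Completeness of the ball in \<open>X\<close> passes to its image through the isometry, also when the target space is
incomplete.\<close>

lemma closed_image_ball:
  "closed (T ` {x \<in> X. norm x \<le> \<rho> / 2})"
proof -
  let ?B = "{x \<in> X. norm x \<le> \<rho> / 2}"
  have BK: "?B \<subseteq> K" using ball_K \<rho>_pos by auto
  have "complete ?B"
  proof -
    have "?B = X \<inter> cball 0 (\<rho> / 2)" by auto
    then show ?thesis using complX by (simp add: complete_Int_closed)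
  qed
  have "complete (T ` ?B)"
    unfolding complete_def
  proof (intro allI impI, elim conjE)
    fix f assume f: "\<forall>n. f n \<in> T ` ?B" "Cauchy f"
    define g where "g n = inv_into ?B T (f n)" for n
    have g: "g n \<in> ?B" for n
      unfolding g_def using f(1) by (intro inv_into_into) blast
    have fg: "f n = T (g n)" for n
      unfolding g_def using f(1) by (intro f_inv_into_f[symmetric]) blast
    have dist: "dist (T x) (T y) = dist x y" if "x \<in> ?B" "y \<in> ?B" for x y
      using iso BK that by blast
    have "Cauchy g"
      using f(2) unfolding Cauchy_def fg dist[OF g g] .
    from completeE[OF \<open>complete ?B\<close> _ this] g
    obtain l where l: "l \<in> ?B" "g \<longlonglongrightarrow> l" by blast
    have eq: "(\<lambda>n. dist (f n) (T l)) = (\<lambda>n. dist (g n) l)"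
      unfolding fg dist[OF g l(1)] ..
    have "(\<lambda>n. dist (f n) (T l)) \<longlonglongrightarrow> 0"
      unfolding eq by (rule tendsto_dist_iff[THEN iffD1, OF l(2)])
    then have "f \<longlonglongrightarrow> T l" by (rule tendsto_dist_iff[THEN iffD2])
    then show "\<exists>l\<in>T ` ?B. f \<longlonglongrightarrow> l" using l(1) by blast
  qed
  then show ?thesis by (rule complete_imp_closed)
qed

text \<open>On convex combinations of slopes this is convexity of the image; points in the closure are reached
by \<open>closed_image_ball\<close>.\<close>

lemma scaled_slope_hull_in_image:
  assumes v: "v \<in> slope_hull" and s: "0 \<le> s" "s \<le> \<rho> / 2"
  shows "s *\<^sub>R v \<in> T ` K"
proof -
  let ?B = "{x \<in> X. norm x \<le> \<rho> / 2}"
  have in_ball: "y \<in> T ` ?B" if y: "y \<in> T ` K" "norm y \<le> \<rho> / 2" for y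
    using y norm_T KX by auto
  have "s *\<^sub>R v \<in> T ` ?B" if v: "v \<in> convex hull (slope ` E)" for v
  proof -
    have 1: "convex hull (slope ` E) \<subseteq> {v. norm v \<le> 1 \<and> s *\<^sub>R v \<in> T ` K}"
    proof (rule hull_minimal)
      show "slope ` E \<subseteq> {v. norm v \<le> 1 \<and> s *\<^sub>R v \<in> T ` K}"
      proof clarify
        fix u assume u: "u \<in> E"
        have K: "(\<rho> / 2) *\<^sub>R u \<in> K" "s *\<^sub>R u \<in> K"
          using step_in_K[of 0 u "\<rho> / 2"] step_in_K[of 0 u s] s u EX norm_E zero_X \<rho>_pos by auto
        have "norm (slope u) = norm u"
          using norm_T[OF K(1)] \<rho>_pos by (simp add: slope_def field_simps)
        then have "norm (slope u) \<le> 1" using norm_E[OF u] by simp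
        moreover have "s *\<^sub>R slope u \<in> T ` K"
          using T_scaled_direction[OF u s] K(2) by (metis imageI)
        ultimately show "norm (slope u) \<le> 1 \<and> s *\<^sub>R slope u \<in> T ` K" by blast
      qed
      have "convex ((*\<^sub>R) s -` (T ` K))"
        by (rule convex_linear_vimage[OF _ convex_image]) (simp add: bounded_linear.linear bounded_linear_scaleR_right)
      moreover have "{v. norm v \<le> 1 \<and> s *\<^sub>R v \<in> T ` K} = cball 0 1 \<inter> (*\<^sub>R) s -` (T ` K)" by auto
      ultimately show "convex {v. norm v \<le> 1 \<and> s *\<^sub>R v \<in> T ` K}" by (simp add: convex_Int)
    qed
    then have "norm v \<le> 1" "s *\<^sub>R v \<in> T ` K" using v by auto
    moreover have "norm (s *\<^sub>R v) \<le> \<rho> / 2"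
      using s \<open>norm v \<le> 1\<close> mult_left_le[of "norm v" s] by simp
    ultimately show ?thesis by (blast intro: in_ball)
  qed
  then have "(*\<^sub>R) s ` closure (convex hull (slope ` E)) \<subseteq> T ` ?B"
    using closed_image_ball
    by (intro image_closure_subset) (auto intro!: continuous_intros)
  then have "s *\<^sub>R v \<in> T ` ?B" using v unfolding slope_hull_def by blast
  then show ?thesis using ball_K \<rho>_pos by auto
qed

text \<open>Points of the image of norm at most \<open>r \<rho> / 6\<close> are in \<open>\<rho> / 6\<close> times the symmetric convex set
\<open>slope_hull\<close>. A signed sum of three of them is in \<open>\<rho> / 2\<close> times that set, hence in the image again.\<close>

lemma small_combination_in_image:
  assumes y: "y1 \<in> T ` K" "y2 \<in> T ` K" "y3 \<in> T ` K"
    and n: "norm y1 \<le> r * \<rho> / 6" "norm y2 \<le> r * \<rho> / 6" "norm y3 \<le> r * \<rho> / 6"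
  shows "y1 + y2 - y3 \<in> T ` K"
proof -
  obtain u where u: "u \<in> E"
    using ball_hull[OF zero_X] rpos by fastforce
  have slopes_sub: "slope ` E \<subseteq> slope_hull"
    unfolding slope_hull_def by (meson closure_subset hull_subset order_trans)
  have "(1/2) *\<^sub>R slope u + (1/2) *\<^sub>R slope (- u) \<in> slope_hull"
    using slopes_sub u uminus_E by (intro convexD[OF convex_slope_hull]) auto
  then have zero_slope_hull: "0 \<in> slope_hull" by (simp add: slope_minus[OF u])
  have scale: "\<exists>v\<in>slope_hull. y = (\<rho> / 6) *\<^sub>R v" if yK: "y \<in> T ` K" and ny: "norm y \<le> r * \<rho> / 6" for y
  proof (cases "y = 0")
    case True then show ?thesis using zero_slope_hull by (intro bexI[of _ 0]) auto
  next
    case False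
    define v where "v = (r / norm y) *\<^sub>R y"
    define t where "t = norm y / (r * \<rho> / 6)"
    have t: "0 \<le> t" "t \<le> 1" using ny rpos \<rho>_pos by (simp_all add: t_def)
    have "v \<in> slope_hull" unfolding v_def by (rule image_direction_in_slope_hull[OF yK False])
    then have "t *\<^sub>R v + (1 - t) *\<^sub>R 0 \<in> slope_hull"
      using zero_slope_hull t by (intro convexD[OF convex_slope_hull]) auto
    moreover have "y = (\<rho> / 6) *\<^sub>R (t *\<^sub>R v)"
      using False rpos \<rho>_pos by (simp add: t_def v_def)
    ultimately show ?thesis by (intro bexI[of _ "t *\<^sub>R v"]) simp_all
  qed
  obtain v1 v2 v3 where v: "v1 \<in> slope_hull" "v2 \<in> slope_hull" "v3 \<in> slope_hull"
    and yv: "y1 = (\<rho> / 6) *\<^sub>R v1" "y2 = (\<rho> / 6) *\<^sub>R v2" "y3 = (\<rho> / 6) *\<^sub>R v3"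
    using scale[OF y(1) n(1)] scale[OF y(2) n(2)] scale[OF y(3) n(3)] by blast
  define w where "w = (1/3) *\<^sub>R v1 + (2/3) *\<^sub>R ((1/2) *\<^sub>R v2 + (1/2) *\<^sub>R (- v3))"
  have "w \<in> slope_hull"
    unfolding w_def using v slope_hull_symmetric by (intro convexD[OF convex_slope_hull]) auto
  then have "(\<rho> / 2) *\<^sub>R w \<in> T ` K"
    using \<rho>_pos by (intro scaled_slope_hull_in_image) auto
  moreover have "(\<rho> / 2) *\<^sub>R w = y1 + y2 - y3"
    by (simp add: w_def yv scaleR_add_right scaleR_diff_right)
  ultimately show ?thesis by simp
qed

text \<open>\<open>H\<close> is the set of all metric midpoints of \<open>p\<close> and \<open>q\<close>. It is symmetric about \<open>m\<close>; by
\<open>small_combination_in_image\<close> its image is symmetric about the midpoint of \<open>T p\<close> and \<open>T q\<close>. Pulling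
this second symmetry back along \<open>T\<close> gives an isometry \<open>g\<close> of \<open>H\<close>, which has to fix \<open>m\<close>.\<close>

lemma local_midpoint:
  "\<exists>\<delta>>0. \<forall>p\<in>X. \<forall>q\<in>X. norm p \<le> \<delta> \<longrightarrow> norm q \<le> \<delta> \<longrightarrow>
     T p + T q = 2 *\<^sub>R T ((1/2) *\<^sub>R (p + q))"
proof -
  define \<delta> where "\<delta> = min (r * \<rho> / 6) \<rho>"
  have \<delta>: "0 < \<delta>" "\<delta> \<le> r * \<rho> / 6" "\<delta> \<le> \<rho>"
    using rpos \<rho>_pos by (auto simp: \<delta>_def)
  have "T p + T q = 2 *\<^sub>R T ((1/2) *\<^sub>R (p + q))"
    if pq: "p \<in> X" "q \<in> X" "norm p \<le> \<delta> / 2" "norm q \<le> \<delta> / 2" for p q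
  proof -
    define m where "m = (1/2) *\<^sub>R (p + q)"
    define d where "d = norm (p - q) / 2"
    define H where "H = {x \<in> X. norm (x - p) \<le> d \<and> norm (x - q) \<le> d}"
    have d: "d \<le> \<delta> / 2" using norm_triangle_ineq4[of p q] pq by (simp add: d_def)
    have nH: "norm x \<le> \<delta>" if "x \<in> H" for x
      using norm_triangle_sub[of x p] that pq d by (auto simp: H_def)
    have HK: "x \<in> K" if "x \<in> H" for x
      using nH[OF that] \<delta> that by (intro ball_K) (auto simp: H_def)
    have pqK: "p \<in> K" "q \<in> K" using pq \<delta> by (auto intro!: ball_K)
    have m2: "2 *\<^sub>R m = p + q" by (simp add: m_def)
    have mp: "m - p = - ((1/2) *\<^sub>R (p - q))" "m - q = (1/2) *\<^sub>R (p - q)"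
      using scaleR_half_double[of p] scaleR_half_double[of q] by (simp_all add: m_def algebra_simps)
    have mH: "m \<in> H"
    proof -
      have "m \<in> X" unfolding m_def using pq subX by (blast intro: subspace_add subspace_scale)
      then show ?thesis unfolding H_def mem_Collect_eq mp norm_minus_cancel by (simp add: d_def)
    qed
    have bdd: "bounded H" using nH by (auto simp: bounded_iff)
    have refl: "2 *\<^sub>R m - x \<in> H" if "x \<in> H" for x
    proof -
      have "p + q - x \<in> X" using that pq subX by (auto simp: H_def intro: subspace_add subspace_diff)
      moreover have "norm (p + q - x - p) = norm (x - q)" "norm (p + q - x - q) = norm (x - p)"
        by (simp_all add: norm_minus_commute)
      ultimately show ?thesis using that by (simp add: H_def m2)
    qed
    have inj: "inj_on T K" using iso by (intro inj_onI) (metis dist_eq_0_iff)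
    define g where "g x = inv_into K T (T p + T q - T x)" for x
    have gH: "g x \<in> H \<and> T (g x) = T p + T q - T x" if x: "x \<in> H" for x
    proof -
      have "T p + T q - T x \<in> T ` K"
      proof (rule small_combination_in_image)
        show "norm (T p) \<le> r * \<rho> / 6" "norm (T q) \<le> r * \<rho> / 6" "norm (T x) \<le> r * \<rho> / 6"
          using norm_T[OF pqK(1)] norm_T[OF pqK(2)] norm_T[OF HK[OF x]] nH[OF x] pq \<delta> by auto
      qed (use pqK HK x in auto)
      then have gK: "g x \<in> K" and Tg: "T (g x) = T p + T q - T x"
        unfolding g_def by (auto intro: inv_into_into f_inv_into_f)
      have "norm (g x - p) = norm (T (g x) - T p)" "norm (g x - q) = norm (T (g x) - T q)"
        using iso[OF gK pqK(1)] iso[OF gK pqK(2)] by (simp_all add: dist_norm)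
      then have "norm (g x - p) = norm (T x - T q)" "norm (g x - q) = norm (T x - T p)"
        by (simp_all add: Tg norm_minus_commute)
      moreover have "norm (T x - T q) = norm (x - q)" "norm (T x - T p) = norm (x - p)"
        using iso[OF HK[OF x] pqK(1)] iso[OF HK[OF x] pqK(2)] by (simp_all add: dist_norm)
      ultimately show ?thesis using x gK KX Tg by (auto simp: H_def)
    qed
    have gg: "g (g x) = x" if x: "x \<in> H" for x
    proof (rule inj_onD[OF inj])
      show "T (g (g x)) = T x" using gH[OF x] gH[of "g x"] by simp
      show "g (g x) \<in> K" "x \<in> K" using gH x HK by blast+
    qed
    have "g m = m"
    proof (rule isometry_fixes_center[OF bdd mH refl])
      show "bij_betw g H H"
        by (rule bij_betw_byWitness[of _ g]) (use gg gH in auto)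
      show "dist (g x) (g y) = dist x y" if xy: "x \<in> H" "y \<in> H" for x y
      proof -
        have gK: "g x \<in> K" "g y \<in> K" using gH xy HK by blast+
        have "dist (g x) (g y) = dist (T (g x)) (T (g y))" using iso[OF gK] by simp
        also have "\<dots> = dist (T x) (T y)"
          using gH xy by (simp add: dist_norm norm_minus_commute)
        also have "\<dots> = dist x y" using iso HK xy by simp
        finally show ?thesis .
      qed
    qed
    then have "T m = T p + T q - T m" using gH[OF mH] by simp
    then show ?thesis by (simp add: m_def[symmetric] scaleR_2 eq_diff_eq)
  qed
  then show ?thesis using \<delta> by (intro exI[of _ "\<delta> / 2"]) auto
qed

end

section \<open>The strong Mankiewicz property from extreme points\<close>

context extreme_directions
begin

definition inner_point :: "'a set \<Rightarrow> 'a \<Rightarrow> bool" where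
  "inner_point K c \<longleftrightarrow> c \<in> X \<and> (\<exists>\<rho>>0. \<forall>z\<in>X. norm (z - c) \<le> \<rho> \<longrightarrow> z \<in> K)"

lemma inner_point_segment:
  assumes K: "convex K" "K \<subseteq> X" and x: "inner_point K x" and y: "y \<in> K" and t: "0 \<le> t" "t < 1"
  shows "inner_point K ((1 - t) *\<^sub>R x + t *\<^sub>R y)"
proof -
  obtain \<rho> where \<rho>: "0 < \<rho>" "\<And>z. z \<in> X \<Longrightarrow> norm (z - x) \<le> \<rho> \<Longrightarrow> z \<in> K" and xX: "x \<in> X"
    using x by (auto simp: inner_point_def)
  have yX: "y \<in> X" using y K by blast
  let ?c = "(1 - t) *\<^sub>R x + t *\<^sub>R y"
  have "z \<in> K" if z: "z \<in> X" "norm (z - ?c) \<le> (1 - t) * \<rho>" for z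
  proof -
    define w where "w = x + (1 / (1 - t)) *\<^sub>R (z - ?c)"
    have cX: "?c \<in> X" using xX yX subX by (blast intro: subspace_add subspace_scale)
    then have "w \<in> X" unfolding w_def using z xX subX
      by (blast intro: subspace_add subspace_scale subspace_diff)
    moreover have "norm (w - x) \<le> \<rho>"
      using z(2) t by (simp add: w_def divide_le_eq mult.commute)
    ultimately have "w \<in> K" using \<rho> by blast
    then have "(1 - t) *\<^sub>R w + t *\<^sub>R y \<in> K" using y t by (intro convexD[OF K(1)]) auto
    moreover have "(1 - t) *\<^sub>R w = (1 - t) *\<^sub>R x + (z - ?c)"
      using t by (simp add: w_def scaleR_add_right)
    ultimately show ?thesis by simp
  qed
  moreover have "?c \<in> X" using xX yX subX by (blast intro: subspace_add subspace_scale)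
  moreover have "0 < (1 - t) * \<rho>" using t \<rho> by simp
  ultimately show ?thesis unfolding inner_point_def by blast
qed

lemma midpoint_near_inner_point:
  fixes T :: "'a \<Rightarrow> 'y::real_normed_vector"
  assumes KX: "K \<subseteq> X" and conv: "convex (T ` K)"
    and iso: "\<And>x y. x \<in> K \<Longrightarrow> y \<in> K \<Longrightarrow> dist (T x) (T y) = dist x y"
    and c: "inner_point K c"
  shows "\<exists>\<delta>>0. \<forall>v\<in>X. norm v \<le> \<delta> \<longrightarrow> T (c - v) + T (c + v) = 2 *\<^sub>R T c"
proof -
  obtain \<rho> where \<rho>: "0 < \<rho>" "\<And>z. z \<in> X \<Longrightarrow> norm (z - c) \<le> \<rho> \<Longrightarrow> z \<in> K" and cX: "c \<in> X"
    using c by (auto simp: inner_point_def)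
  interpret centered_isometry X E r "(\<lambda>x. x - c) ` K" "\<lambda>x. T (x + c) - T c" \<rho>
  proof
    show "(\<lambda>x. x - c) ` K \<subseteq> X" using KX cX subX by (auto intro: subspace_diff)
    have "(\<lambda>x. T (x + c) - T c) ` (\<lambda>x. x - c) ` K = (\<lambda>y. y - T c) ` (T ` K)"
      by (auto simp: image_image)
    then show "convex ((\<lambda>x. T (x + c) - T c) ` (\<lambda>x. x - c) ` K)"
      using conv by (simp add: convex_translation_subtract_eq)
    show "dist (T (x + c) - T c) (T (y + c) - T c) = dist x y"
      if "x \<in> (\<lambda>x. x - c) ` K" "y \<in> (\<lambda>x. x - c) ` K" for x y
      using that iso by (auto simp: dist_norm)
    show "x \<in> (\<lambda>x. x - c) ` K" if "x \<in> X" "norm x \<le> \<rho>" for x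
    proof -
      have "x + c \<in> K" using that cX subX by (intro \<rho>(2)) (auto intro: subspace_add)
      then show ?thesis by (intro image_eqI[of _ _ "x + c"]) auto
    qed
  qed (use \<rho> in auto)
  obtain \<delta> where \<delta>: "\<delta> > 0" "\<And>p q. p \<in> X \<Longrightarrow> q \<in> X \<Longrightarrow> norm p \<le> \<delta> \<Longrightarrow> norm q \<le> \<delta> \<Longrightarrow>
      (T (p + c) - T c) + (T (q + c) - T c) = 2 *\<^sub>R (T ((1/2) *\<^sub>R (p + q) + c) - T c)"
    using local_midpoint by blast
  have "T (c - v) + T (c + v) = 2 *\<^sub>R T c" if v: "v \<in> X" "norm v \<le> \<delta>" for v
  proof -
    have "- v \<in> X" using v subX by (blast intro: subspace_neg)
    then have "(T (c - v) - T c) + (T (c + v) - T c) = 0"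
      using \<delta>(2)[of "- v" v] v by (simp add: add.commute)
    then show ?thesis by (simp add: scaleR_2 algebra_simps)
  qed
  then show ?thesis using \<delta>(1) by blast
qed

text \<open>Except possibly for \<open>y\<close>, all points of the segment from \<open>x\<close> to \<open>y\<close> are interior, and there \<open>T\<close>
preserves small midpoints.\<close>

lemma affine_from_inner_point:
  fixes T :: "'a \<Rightarrow> 'y::real_normed_vector"
  assumes K: "convex K" and KX: "K \<subseteq> X" and conv: "convex (T ` K)"
    and iso: "\<And>x y. x \<in> K \<Longrightarrow> y \<in> K \<Longrightarrow> dist (T x) (T y) = dist x y"
    and x: "inner_point K x" and y: "y \<in> K" and t: "0 \<le> t" "t \<le> 1"
  shows "T ((1 - t) *\<^sub>R x + t *\<^sub>R y) = (1 - t) *\<^sub>R T x + t *\<^sub>R T y"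
proof -
  define f where "f = (\<lambda>t. T ((1 - t) *\<^sub>R x + t *\<^sub>R y))"
  have xK: "x \<in> K" using x by (force simp: inner_point_def)
  have inK: "(1 - t) *\<^sub>R x + t *\<^sub>R y \<in> K" if "t \<in> {0..1}" for t
    using that xK y by (intro convexD[OF K]) auto
  have "(norm (y - x))-lipschitz_on {0..1} f"
  proof (rule lipschitz_onI)
    fix t t' :: real assume tt: "t \<in> {0..1}" "t' \<in> {0..1}"
    have "dist (f t) (f t') = norm (((1 - t) *\<^sub>R x + t *\<^sub>R y) - ((1 - t') *\<^sub>R x + t' *\<^sub>R y))"
      using iso[OF inK[OF tt(1)] inK[OF tt(2)]] by (simp add: f_def dist_norm)
    also have "\<dots> = norm ((t - t') *\<^sub>R (y - x))"
      by (rule arg_cong[where f = norm]) (simp add: algebra_simps)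
    finally show "dist (f t) (f t') \<le> norm (y - x) * dist t t'"
      by (simp add: dist_norm mult.commute)
  qed simp
  then have cont: "continuous_on {0..1} f" by (rule lipschitz_on_continuous_on)
  have "f t = (1 - t) *\<^sub>R f 0 + t *\<^sub>R f 1"
  proof (rule locally_midpoint_affine_imp_affine[OF cont])
    fix t :: real assume t: "0 < t" "t < 1"
    let ?c = "(1 - t) *\<^sub>R x + t *\<^sub>R y"
    obtain \<delta> where \<delta>: "\<delta> > 0" "\<And>v. v \<in> X \<Longrightarrow> norm v \<le> \<delta> \<Longrightarrow> T (?c - v) + T (?c + v) = 2 *\<^sub>R T ?c"
      using midpoint_near_inner_point[OF KX conv iso inner_point_segment[OF K KX x y]] t
      by (metis less_eq_real_def)
    define e where "e = \<delta> / (norm (y - x) + 1)"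
    have e: "e > 0" using \<delta> by (simp add: e_def add_nonneg_pos)
    have "f (t - h) + f (t + h) = 2 *\<^sub>R f t" if h: "0 < h" "h < e" for h
    proof -
      have "h * (norm (y - x) + 1) < \<delta>"
        using h(2) by (simp add: e_def less_divide_eq add_nonneg_pos)
      then have "norm (h *\<^sub>R (y - x)) \<le> \<delta>" using h by (simp add: distrib_left)
      moreover have "h *\<^sub>R (y - x) \<in> X"
        using xK y KX subX by (blast intro: subspace_scale subspace_diff)
      ultimately have "T (?c - h *\<^sub>R (y - x)) + T (?c + h *\<^sub>R (y - x)) = 2 *\<^sub>R T ?c"
        using \<delta>(2) by blast
      moreover have "?c - h *\<^sub>R (y - x) = (1 - (t - h)) *\<^sub>R x + (t - h) *\<^sub>R y"
        "?c + h *\<^sub>R (y - x) = (1 - (t + h)) *\<^sub>R x + (t + h) *\<^sub>R y"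
        by (simp_all add: algebra_simps)
      ultimately show ?thesis unfolding f_def by metis
    qed
    then show "\<exists>\<delta>>0. \<forall>h. 0 < h \<and> h < \<delta> \<longrightarrow> f (t - h) + f (t + h) = 2 *\<^sub>R f t"
      using e by blast
  qed (use t in auto)
  then show ?thesis by (simp add: f_def)
qed

text \<open>If neither end is interior, approximate \<open>x\<close> from inside along the segment from an interior point.\<close>

theorem isometry_affine:
  fixes T :: "'a \<Rightarrow> 'y::real_normed_vector"
  assumes K: "convex K" and KX: "K \<subseteq> X" and conv: "convex (T ` K)"
    and iso: "\<And>x y. x \<in> K \<Longrightarrow> y \<in> K \<Longrightarrow> dist (T x) (T y) = dist x y"
    and c: "inner_point K c" and x: "x \<in> K" and y: "y \<in> K" and t: "0 \<le> t" "t \<le> 1"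
  shows "T (t *\<^sub>R x + (1 - t) *\<^sub>R y) = t *\<^sub>R T x + (1 - t) *\<^sub>R T y"
proof -
  note affine = affine_from_inner_point[OF K KX conv iso]
  \<comment> \<open>The parameters tend to \<open>1\<close> but stay below it, where the points are interior.\<close>
  define s :: "nat \<Rightarrow> real" where "s n = 1 - inverse (real (Suc n))" for n
  have s: "0 \<le> s n" "s n < 1" for n
    by (auto simp: s_def inverse_le_1_iff)
  have s1: "s \<longlonglongrightarrow> 1"
    unfolding s_def using tendsto_diff[OF tendsto_const LIMSEQ_inverse_real_of_nat, of 1] by simp
  define X' where "X' n = (1 - s n) *\<^sub>R c + s n *\<^sub>R x" for n
  have X': "inner_point K (X' n)" for n
    unfolding X'_def by (rule inner_point_segment[OF K KX c x s])
  have cK: "c \<in> K" using c by (force simp: inner_point_def)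
  have X'K: "X' n \<in> K" for n
    using X'[of n] by (force simp: inner_point_def)
  have "X' \<longlonglongrightarrow> (1 - 1) *\<^sub>R c + 1 *\<^sub>R x"
    unfolding X'_def by (intro tendsto_intros s1)
  then have X'lim: "X' \<longlonglongrightarrow> x" by simp
  have contT: "(\<lambda>n. T (z n)) \<longlonglongrightarrow> T l" if "\<And>n. z n \<in> K" "l \<in> K" "z \<longlonglongrightarrow> l" for z l
  proof -
    have "dist (T (z n)) (T l) = dist (z n) l" for n using iso that by blast
    then show ?thesis
      using that(3) unfolding tendsto_dist_iff[of "\<lambda>n. T (z n)"] tendsto_dist_iff[of z] by presburger
  qed
  have inK: "t *\<^sub>R a + (1 - t) *\<^sub>R y \<in> K" if "a \<in> K" for a
    using that y t by (intro convexD[OF K]) auto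
  have "(\<lambda>n. T (t *\<^sub>R X' n + (1 - t) *\<^sub>R y)) \<longlonglongrightarrow> T (t *\<^sub>R x + (1 - t) *\<^sub>R y)"
    by (intro contT inK X'K x tendsto_intros X'lim)
  moreover have "T (t *\<^sub>R X' n + (1 - t) *\<^sub>R y) = t *\<^sub>R T (X' n) + (1 - t) *\<^sub>R T y" for n
    using affine[OF _ _ X'[of n] y, of "1 - t"] t by simp
  moreover have "(\<lambda>n. t *\<^sub>R T (X' n) + (1 - t) *\<^sub>R T y) \<longlonglongrightarrow> t *\<^sub>R T x + (1 - t) *\<^sub>R T y"
    by (intro tendsto_intros contT X'K x X'lim)
  ultimately show ?thesis using LIMSEQ_unique by force
qed

theorem strong_mankiewicz:
  assumes "convex_body_in X K"
  shows "strong_mankiewicz_property TYPE('y::real_normed_vector) K"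
proof -
  have K: "convex K" "K \<subseteq> X" and ne: "top_of_set X interior_of K \<noteq> {}"
    using assms by (auto simp: convex_body_in_def)
  then obtain c where c: "c \<in> top_of_set X interior_of K" by blast
  then obtain U where U: "openin (top_of_set X) U" "c \<in> U" "U \<subseteq> K"
    by (auto simp: interior_of_def)
  then have "U \<subseteq> X" and ball: "\<forall>x\<in>U. \<exists>e>0. ball x e \<inter> X \<subseteq> U"
    unfolding openin_contains_ball by blast+
  then have cX: "c \<in> X" using U by blast
  obtain e where e: "e > 0" "ball c e \<inter> X \<subseteq> U" using ball U(2) by blast
  have "inner_point K c"
    unfolding inner_point_def
  proof (intro conjI exI[of _ "e / 2"] ballI impI)
    fix z assume "z \<in> X" "norm (z - c) \<le> e / 2"
    then have "z \<in> ball c e \<inter> X" using e by (simp add: dist_norm norm_minus_commute)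
    then show "z \<in> K" using e U by blast
  qed (use e cX in auto)
  then show ?thesis
    unfolding strong_mankiewicz_property_def
    by (intro allI impI ballI isometry_affine[OF K(1) K(2)]) auto
qed

end

section \<open>Unitaries as extreme points\<close>

text \<open>The set \<open>D\<close> of all \<open>x\<close> with both norms at most \<open>1\<close> is stable under the Newton step
\<open>(3 x - x\<^sup>3) / 2\<close> for the sign function, since \<open>1 - (3 x - x\<^sup>3) / 2 = (1 - x)\<^sup>2 (1 + x / 2)\<close>. On
the other hand \<open>4 x = (1 + x)\<^sup>2 - (1 - x)\<^sup>2\<close> bounds \<open>D\<close> by \<open>1 / 2\<close>, and on that ball the Newton step
stretches norms by at least \<open>11 / 8 = 3 / 2 - 1 / 8\<close>. So \<open>D\<close> contains only \<open>0\<close>.\<close>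

lemma one_extreme_in_unit_ball:
  fixes x :: "'a::{real_normed_algebra, monoid_mult}"
  assumes "norm (1 + x) \<le> 1" "norm (1 - x) \<le> 1"
  shows "x = 0"
proof -
  define D where "D = {x::'a. norm (1 + x) \<le> 1 \<and> norm (1 - x) \<le> 1}"
  have mult_le: "norm (a * b) \<le> 1" if "norm a \<le> 1" "norm b \<le> 1" for a b :: 'a
    using norm_mult_ineq[of a b] mult_mono[OF that] by simp
  have half: "norm x \<le> 1 / 2" if x: "x \<in> D" for x
  proof -
    have "4 *\<^sub>R x = (1 + x) * (1 + x) - (1 - x) * (1 - x)"
      using scaleR_add_left[of 2 2 x] by (simp add: algebra_simps scaleR_2)
    also have "norm \<dots> \<le> 1 + 1"
      using x by (intro norm_triangle_ineq4[THEN order_trans, OF add_mono] mult_le) (auto simp: D_def)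
    finally show ?thesis by simp
  qed
  have newton: "(3/2) *\<^sub>R x - (1/2) *\<^sub>R (x * x * x) \<in> D" if x: "x \<in> D" for x
  proof -
    have half_step: "norm (1 + (1/2) *\<^sub>R y) \<le> 1" if y: "norm (1 + y) \<le> 1" "norm (1 - y) \<le> 1" for y :: 'a
    proof -
      have "norm (1::'a) \<le> 1"
        using norm_triangle_le[OF add_mono[OF y]] by (simp flip: scaleR_2)
      moreover have "1 + (1/2) *\<^sub>R y = (1/2) *\<^sub>R (1::'a) + (1/2) *\<^sub>R (1 + y)"
        using scaleR_half_double[of "1::'a"] by (simp add: scaleR_add_right)
      ultimately show ?thesis
        using norm_triangle_ineq[of "(1/2) *\<^sub>R (1::'a)" "(1/2) *\<^sub>R (1 + y)"] y(1) by simp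
    qed
    have 1: "norm ((1 - y) * (1 - y) * (1 + (1/2) *\<^sub>R y)) \<le> 1"
      if "norm (1 + y) \<le> 1" "norm (1 - y) \<le> 1" for y :: 'a
      using that by (intro mult_le half_step)
    have 2: "(1 - y) * (1 - y) * (1 + (1/2) *\<^sub>R y) = 1 - ((3/2) *\<^sub>R y - (1/2) *\<^sub>R (y * y * y))" for y :: 'a
    proof -
      have "y + y = (3/2) *\<^sub>R y + (1/2) *\<^sub>R y" "y * y = (1/4) *\<^sub>R (y * y) + (3/4) *\<^sub>R (y * y)"
        by (simp_all flip: scaleR_add_left scaleR_2)
      then show ?thesis by (simp add: algebra_simps)
    qed
    have pos: "norm (1 - ((3/2) *\<^sub>R x - (1/2) *\<^sub>R (x * x * x))) \<le> 1"
      using 1[of x] x unfolding 2 by (auto simp: D_def)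
    have neg: "norm (1 - ((3/2) *\<^sub>R (-x) - (1/2) *\<^sub>R ((-x) * (-x) * (-x)))) \<le> 1"
      using 1[of "-x"] x unfolding 2 by (auto simp: D_def)
    have eq: "1 - ((3/2) *\<^sub>R (-x) - (1/2) *\<^sub>R ((-x) * (-x) * (-x))) =
        1 + ((3/2) *\<^sub>R x - (1/2) *\<^sub>R (x * x * x))" by simp
    have "norm (1 + ((3/2) *\<^sub>R x - (1/2) *\<^sub>R (x * x * x))) \<le> 1"
      using neg unfolding eq .
    with pos show ?thesis by (simp add: D_def)
  qed
  have grow: "(11/8) ^ n * norm x \<le> 1/2" if "x \<in> D" for n x
    using that
  proof (induction n arbitrary: x)
    case 0
    then show ?case using half by simp
  next
    case (Suc n)
    let ?y = "(3/2) *\<^sub>R x - (1/2) *\<^sub>R (x * x * x)"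
    have "norm (x * x * x) \<le> norm x * norm x * norm x"
      by (meson norm_mult_ineq mult_right_mono norm_ge_zero order_trans)
    also have "\<dots> \<le> (1/2) * (1/2) * norm x"
      using half[OF Suc.prems] by (intro mult_right_mono mult_mono) auto
    finally have "norm ((1/2) *\<^sub>R (x * x * x)) \<le> (1/8) * norm x" by simp
    then have "(11/8) * norm x \<le> norm ?y"
      using norm_triangle_ineq2[of "(3/2) *\<^sub>R x" "(1/2) *\<^sub>R (x * x * x)"] by simp
    then have "(11/8) ^ n * ((11/8) * norm x) \<le> (11/8) ^ n * norm ?y"
      by (intro mult_left_mono) auto
    also have "\<dots> \<le> 1/2" by (rule Suc.IH[OF newton[OF Suc.prems]])
    finally show ?case by (simp add: mult_ac)
  qed
  have "x \<in> D" using assms by (simp add: D_def)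
  show ?thesis
  proof (rule ccontr)
    assume "x \<noteq> 0"
    obtain n where "(1/2) / norm x < (11/8) ^ n"
      using real_arch_pow[of "11/8" "(1/2) / norm x"] by auto
    then show False using grow[OF \<open>x \<in> D\<close>, of n] \<open>x \<noteq> 0\<close> by (simp add: field_simps)
  qed
qed

lemma scaleC_minus_right: "c *\<^sub>C (- x) = - (c *\<^sub>C (x::'a::complex_normed_vector))"
proof -
  have "c *\<^sub>C (0::'a) = 0" using scaleC_add_right[of c 0 "0::'a"] by simp
  then show ?thesis using scaleC_add_right[of c x "- x"] by (simp add: eq_neg_iff_add_eq_0 add.commute)
qed

lemma scaleC_ii_ii: "\<i> *\<^sub>C \<i> *\<^sub>C x = - (x::'a::complex_normed_vector)"
  using scaleC_scaleC[of \<i> \<i> x] scaleC_of_real[of "-1" x] by simp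

lemma scaleC_scaleR: "c *\<^sub>C r *\<^sub>R x = r *\<^sub>R c *\<^sub>C (x::'a::complex_normed_vector)"
  by (simp add: scaleC_scaleC mult.commute flip: scaleC_of_real)

lemma scaleC_minus_left: "(- c) *\<^sub>C x = - (c *\<^sub>C (x::'a::complex_normed_vector))"
  using scaleC_scaleC[of "-1" c x] scaleC_of_real[of "-1" "c *\<^sub>C x"] by simp

lemma star_zero: "star (0::'a::unital_cstar_algebra) = 0"
  using star_add[of 0 "0::'a"] by simp

lemma star_minus: "star (- x) = - star (x::'a::unital_cstar_algebra)"
  using star_add[of x "- x"] by (simp add: star_zero eq_neg_iff_add_eq_0 add.commute)

lemma star_diff: "star (x - y) = star x - star (y::'a::unital_cstar_algebra)"
  using star_add[of x "- y"] by (simp add: star_minus)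

lemma star_scaleR: "star (r *\<^sub>R x) = r *\<^sub>R star (x::'a::unital_cstar_algebra)"
  using star_scaleC[of "complex_of_real r" x] by (simp add: scaleC_of_real)

lemma star_one: "star (1::'a::unital_cstar_algebra) = 1"
  by (metis mult_1 star_mult star_star)

lemma norm_star: "norm (star x) = norm (x::'a::unital_cstar_algebra)"
proof -
  have le: "norm z \<le> norm (star z)" for z :: 'a
  proof (cases "z = 0")
    case False
    have "norm z * norm z \<le> norm (star z) * norm z"
      using cstar_identity[of z] norm_mult_ineq[of "star z" z] by (simp add: power2_eq_square)
    then show ?thesis using False by simp
  qed simp
  show ?thesis using le[of x] le[of "star x"] by (simp add: star_star)
qed

lemma norm_one_le: "norm (1::'a::unital_cstar_algebra) \<le> 1"
proof -
  have "norm (1::'a) * norm (1::'a) = norm (1::'a)"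
    using cstar_identity[of "1::'a"] by (simp add: star_one power2_eq_square)
  then show ?thesis by (cases "norm (1::'a) = 0") auto
qed

lemmas star_simps = star_zero star_minus star_diff star_add star_scaleR star_one star_mult star_star
  star_scaleC

definition unitary :: "'a::unital_cstar_algebra \<Rightarrow> bool" where
  "unitary u \<longleftrightarrow> star u * u = 1 \<and> u * star u = 1"

lemma unitary_star: "unitary u \<Longrightarrow> unitary (star u)"
  by (simp add: unitary_def star_star)

lemma unitary_minus: "unitary u \<Longrightarrow> unitary (- u)"
  by (simp add: unitary_def star_minus)

lemma unitary_scaleC: "unitary u \<Longrightarrow> cmod c = 1 \<Longrightarrow> unitary (c *\<^sub>C u)"
  using scaleC_of_real[of 1] 
  by (simp add: unitary_def star_scaleC scaleC_mult_left scaleC_mult_right scaleC_scaleC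
      complex_norm_square[symmetric] mult.commute[of "cnj c"])

lemma norm_unitary: "unitary u \<Longrightarrow> norm u \<le> 1"
  using cstar_identity[of u] norm_one_le[where 'a='a] abs_square_le_1[of "norm u"]
  by (simp add: unitary_def)

text \<open>Multiplication by \<open>star u\<close> is a contraction that takes \<open>u\<close> to \<open>1\<close>.\<close>

lemma unitary_extreme:
  fixes u d :: "'a::unital_cstar_algebra"
  assumes u: "unitary u" and d: "norm (u + d) \<le> 1" "norm (u - d) \<le> 1"
  shows "d = 0"
proof -
  have *: "norm (star u * z) \<le> 1" if "norm z \<le> 1" for z
    using norm_mult_ineq[of "star u" z] mult_mono[OF norm_unitary[OF unitary_star[OF u]] that] by simp
  have "star u * (u + d) = 1 + star u * d" "star u * (u - d) = 1 - star u * d"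
    using u by (simp_all add: unitary_def distrib_left right_diff_distrib)
  then have "star u * d = 0"
    using *[OF d(1)] *[OF d(2)] by (intro one_extreme_in_unit_ball) auto
  then have "(u * star u) * d = 0" by (simp add: mult.assoc)
  then show ?thesis using u by (simp add: unitary_def)
qed

text \<open>Solving \<open>2 w = x + w\<^sup>2\<close> means \<open>(1 - w)\<^sup>2 = 1 - x\<close>, and \<open>w \<mapsto> (x + w\<^sup>2) / 2\<close> is a contraction of the
ball of radius \<open>norm x < 1\<close>. The solution inherits every closed condition that the iteration
respects, such as membership in a subalgebra, being self-adjoint or commuting with given elements.
The product is a parameter because the lemma is applied both to the product of an algebra and to
composition of operators.\<close>

lemma square_root_iteration:
  fixes prod :: "'b::banach \<Rightarrow> 'b \<Rightarrow> 'b"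
  assumes bil: "bounded_bilinear prod" and sub: "\<And>a b. norm (prod a b) \<le> norm a * norm b"
    and x: "norm x < 1"
    and S: "closed S" "0 \<in> S" "\<And>w. w \<in> S \<Longrightarrow> (1/2) *\<^sub>R (x + prod w w) \<in> S"
  shows "\<exists>w\<in>S. 2 *\<^sub>R w = x + prod w w"
proof -
  interpret bounded_bilinear prod by (rule bil)
  define q where "q = norm x"
  have q: "0 \<le> q" "q < 1" using x by (auto simp: q_def)
  define f where "f w = (1/2) *\<^sub>R (x + prod w w)" for w
  have "\<exists>!w\<in>S \<inter> cball 0 q. f w = w"
  proof (rule Banach_fix)
    show "complete (S \<inter> cball 0 q)"
      using S(1) by (simp add: closed_Int complete_eq_closed)
    show "S \<inter> cball 0 q \<noteq> {}" using S(2) q by auto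
    show "f ` (S \<inter> cball 0 q) \<subseteq> S \<inter> cball 0 q"
    proof clarify
      fix w assume w: "w \<in> S" "w \<in> cball 0 q"
      have "norm (x + prod w w) \<le> q + q * 1"
        using w q by (intro norm_triangle_le add_mono order_trans[OF sub] mult_mono) (auto simp: q_def)
      then show "f w \<in> S \<inter> cball 0 q" using S(3)[OF w(1)] by (simp add: f_def)
    qed
    show "dist (f v) (f w) \<le> q * dist v w" if vw: "v \<in> S \<inter> cball 0 q" "w \<in> S \<inter> cball 0 q" for v w
    proof -
      have "f v - f w = (1/2) *\<^sub>R (prod v (v - w) + prod (v - w) w)"
        by (simp add: f_def diff_left diff_right scaleR_diff_right[symmetric] del: scaleR_diff_right)
      then have "norm (f v - f w) \<le> (1/2) * (norm v * norm (v - w) + norm (v - w) * norm w)"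
        using norm_triangle_le[OF add_mono[OF sub sub], of v "v - w" "v - w" w] by simp
      also have "\<dots> \<le> (1/2) * (q * norm (v - w) + norm (v - w) * q)"
        using vw q by (intro mult_left_mono add_mono mult_mono) auto
      finally show ?thesis by (simp add: dist_norm)
    qed
  qed (use q in auto)
  then obtain w where w: "w \<in> S" "f w = w" by blast
  have "2 *\<^sub>R w = 2 *\<^sub>R f w" using w by simp
  then show ?thesis using w(1) by (auto simp: f_def)
qed

section \<open>Convex hulls of unitaries\<close>

locale closed_real_star_subalgebra =
  fixes A :: "'a::unital_cstar_algebra set"
  assumes subA: "subspace A" and closedA: "closed A" and oneA: "1 \<in> A"
    and multA: "\<And>x y. x \<in> A \<Longrightarrow> y \<in> A \<Longrightarrow> x * y \<in> A"
    and starA: "\<And>x. x \<in> A \<Longrightarrow> star x \<in> A"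
begin

text \<open>With \<open>s = sqrt (1 + k\<^sup>2)\<close> self-adjoint and commuting with \<open>k\<close>, the element \<open>u = k + s\<close> satisfies
\<open>star u * u = (s - k) (s + k) = s\<^sup>2 - k\<^sup>2 = 1\<close>. Here \<open>1 + k\<^sup>2 = 1 - (- k * k)\<close> is covered by
\<open>square_root_iteration\<close>.\<close>

lemma skew_eq_unitary_difference:
  assumes k: "k \<in> A" "star k = - k" "norm k < 1"
  shows "\<exists>u\<in>A. unitary u \<and> k = (1/2) *\<^sub>R (u - star u)"
proof -
  define S where "S = {w\<in>A. star w = w \<and> w * k = k * w}"
  have bl_star: "bounded_linear (star :: 'a \<Rightarrow> 'a)"
    by (rule bounded_linear_intro[of _ 1]) (simp_all add: star_add star_scaleR norm_star)
  have closedS: "closed S"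
  proof -
    have "closed {w::'a. star w = w}" "closed {w. w * k = k * w}"
      by (intro closed_Collect_eq continuous_intros bounded_linear.continuous_on[OF bl_star])+
    moreover have "S = A \<inter> {w. star w = w} \<inter> {w. w * k = k * w}" by (auto simp: S_def)
    ultimately show ?thesis using closedA by (simp add: closed_Int)
  qed
  have "norm (k * k) \<le> norm k * norm k" by (rule norm_mult_ineq)
  also have "\<dots> < 1" using k(3) by (metis mult_strict_mono norm_ge_zero mult_1 zero_less_one)
  finally have nk: "norm (- (k * k)) < 1" by simp
  have "\<exists>w\<in>S. 2 *\<^sub>R w = - (k * k) + w * w"
  proof (rule square_root_iteration[OF bounded_bilinear_mult norm_mult_ineq nk closedS])
    show "0 \<in> S" using subspace_0[OF subA] by (simp add: S_def star_zero)
    fix w assume w: "w \<in> S"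
    have "(1/2) *\<^sub>R (- (k * k) + w * w) \<in> A"
      using w k(1) by (intro subspace_scale subspace_add subspace_neg subA multA) (auto simp: S_def)
    moreover have "w * w * k = k * (w * w)"
      using w by (simp add: S_def mult.assoc) (metis mult.assoc)
    ultimately show "(1/2) *\<^sub>R (- (k * k) + w * w) \<in> S"
      using w k(2) by (simp add: S_def star_simps algebra_simps)
  qed
  then obtain w where w: "w \<in> A" "star w = w" "w * k = k * w" "2 *\<^sub>R w = - (k * k) + w * w"
    by (auto simp: S_def)
  define u where "u = k + (1 - w)"
  have su: "star u = (1 - w) - k" by (simp add: u_def star_simps w(2) k(2))
  have ww: "w * w = w + w + k * k" using w(4) by (simp add: scaleR_2)
  have "star u * u = 1" "u * star u = 1"
    unfolding su unfolding u_def by (simp_all add: algebra_simps ww w(3))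
  moreover have "u \<in> A"
    unfolding u_def using k(1) oneA w(1) by (intro subspace_add subspace_diff subA)
  moreover have "k = (1/2) *\<^sub>R (u - star u)"
    unfolding su by (simp add: u_def)
  ultimately show ?thesis unfolding unitary_def by blast
qed

abbreviation unitaries :: "'a set" where "unitaries \<equiv> {u\<in>A. unitary u}"

lemma skew_in_hull:
  assumes k: "k \<in> A" "star k = - k" "norm k < 1"
  shows "k \<in> convex hull unitaries"
proof -
  obtain u where u: "u \<in> A" "unitary u" "k = (1/2) *\<^sub>R (u - star u)"
    using skew_eq_unitary_difference[OF k] by blast
  have "u \<in> convex hull unitaries" "- star u \<in> convex hull unitaries"
    using u subA by (auto intro!: hull_inc subspace_neg starA unitary_minus unitary_star)
  then have "(1/2) *\<^sub>R u + (1/2) *\<^sub>R (- star u) \<in> convex hull unitaries"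
    by (intro convexD[OF convex_convex_hull]) auto
  then show ?thesis by (simp add: u(3) scaleR_diff_right)
qed

text \<open>Skew-adjoint elements of norm less than \<open>1\<close> are in the convex hull of the unitaries by
\<open>skew_in_hull\<close>, so only self-adjoint ones are left. The radius \<open>1 / 4\<close> comes from writing \<open>x\<close> as the average of \<open>x + star x\<close> and \<open>x - star x\<close>.\<close>

lemma extreme_directions_unitaries:
  assumes sa: "\<And>h. h \<in> A \<Longrightarrow> star h = h \<Longrightarrow> norm h \<le> 1/2 \<Longrightarrow> h \<in> closure (convex hull unitaries)"
  shows "extreme_directions A unitaries (1/4)"
proof
  show "subspace A" by (rule subA)
  show "complete A" using closedA by (simp add: complete_eq_closed)
  fix u assume u: "u \<in> unitaries"
  show "- u \<in> unitaries" using u subA by (auto intro: subspace_neg unitary_minus)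
  show "norm u \<le> 1" using u by (auto intro: norm_unitary)
  show "d = 0" if "d \<in> A" "norm (u + d) \<le> 1" "norm (u - d) \<le> 1" for d
    using u that by (auto intro: unitary_extreme)
next
  fix x assume x: "x \<in> A" "norm x \<le> 1/4"
  have n: "norm (x + star x) \<le> 1/2" "norm (x - star x) \<le> 1/2"
    using norm_triangle_ineq[of x "star x"] norm_triangle_ineq4[of x "star x"] x(2) norm_star[of x]
    by auto
  have A: "x + star x \<in> A" "x - star x \<in> A"
    using x(1) by (auto intro: subspace_add subspace_diff subA starA)
  have "x + star x \<in> closure (convex hull unitaries)"
    using A n by (intro sa) (auto simp: star_simps add.commute)
  moreover have "x - star x \<in> closure (convex hull unitaries)"
    using A n by (intro closure_subset[THEN subsetD] skew_in_hull) (auto simp: star_simps)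
  ultimately have "(1/2) *\<^sub>R (x + star x) + (1/2) *\<^sub>R (x - star x) \<in> closure (convex hull unitaries)"
    by (intro convexD[OF convex_closure[OF convex_convex_hull]]) auto
  moreover have "(1/2) *\<^sub>R (x + star x) + (1/2) *\<^sub>R (x - star x) = x"
    using scaleR_half_double[of x] by (simp add: algebra_simps)
  ultimately show "x \<in> closure (convex hull unitaries)" by simp
qed auto

end

text \<open>For self-adjoint \<open>h\<close> the element \<open>\<i> h\<close> is skew-adjoint, so \<open>\<i> h = (u - star u) / 2\<close> with \<open>u\<close> unitary,
and \<open>h\<close> is the average of the unitaries \<open>- \<i> u\<close> and \<open>\<i> (star u)\<close>.\<close>

lemma extreme_directions_complex:
  "extreme_directions UNIV {u::'a::unital_cstar_algebra. unitary u} (1/4)"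
proof -
  interpret closed_real_star_subalgebra "UNIV :: 'a set" by standard auto
  have "h \<in> closure (convex hull unitaries)" if h: "star h = h" "norm h \<le> 1/2" for h :: 'a
  proof -
    have "\<exists>u\<in>UNIV. unitary u \<and> \<i> *\<^sub>C h = (1/2) *\<^sub>R (u - star u)"
      using h by (intro skew_eq_unitary_difference) (auto simp: star_simps scaleC_minus_left norm_scaleC)
    then obtain u where u: "unitary u" "\<i> *\<^sub>C h = (1/2) *\<^sub>R (u - star u)" by blast
    have "h = - (\<i> *\<^sub>C \<i> *\<^sub>C h)" by (simp add: scaleC_ii_ii)
    also have "\<dots> = (1/2) *\<^sub>R (- (\<i> *\<^sub>C u)) + (1/2) *\<^sub>R (\<i> *\<^sub>C star u)"
      unfolding u(2) scaleC_scaleR using scaleC_add_right[of \<i> u "- star u"]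
      by (simp add: scaleC_minus_right scaleR_diff_right)
    also have "\<dots> \<in> convex hull unitaries"
      using unitary_minus[OF unitary_scaleC[OF u(1), of \<i>]]
        unitary_scaleC[OF unitary_star[OF u(1)], of \<i>]
      by (intro convexD[OF convex_convex_hull] hull_inc) auto
    finally show ?thesis using closure_subset by blast
  qed
  then show ?thesis using extreme_directions_unitaries by simp
qed

section \<open>Order in a concrete von Neumann algebra\<close>

lemma strong_limit_in_closedin:
  fixes f :: "nat \<Rightarrow> 'b::real_normed_vector \<Rightarrow>\<^sub>L 'c::real_normed_vector"
  assumes S: "closedin strong_operator_topology S" "\<And>n. f n \<in> S"
    and lim: "\<And>\<xi>. (\<lambda>n. f n \<xi>) \<longlonglongrightarrow> blinfun_apply W \<xi>"
  shows "W \<in> S"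
proof (rule limitin_closedin[OF _ S(1)])
  show "limitin strong_operator_topology f W sequentially"
    unfolding limitin_def
  proof (intro conjI allI impI)
    show "W \<in> topspace strong_operator_topology" by (simp add: strong_operator_topology_topspace)
    fix U assume U: "openin strong_operator_topology U \<and> W \<in> U"
    then obtain V where V: "open V" "U = blinfun_apply -` V"
      by (auto simp: strong_operator_topology_def openin_pullback_topology)
    have "limitin (product_topology (\<lambda>_. euclidean) UNIV) (\<lambda>n. blinfun_apply (f n)) (blinfun_apply W) sequentially"
      using lim by (simp add: limitin_componentwise)
    then have "(\<lambda>n. blinfun_apply (f n)) \<longlonglongrightarrow> blinfun_apply W"
      by (simp add: euclidean_product_topology)
    then show "eventually (\<lambda>n. f n \<in> U) sequentially"
      using V U by (auto simp: topological_tendstoD)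
  qed
qed (use S(2) in auto)

lemma scaleC_diff_right: "c *\<^sub>C (x - y) = c *\<^sub>C x - c *\<^sub>C (y::'a::complex_normed_vector)"
  using scaleC_add_right[of c x "- y"] by (simp add: scaleC_minus_right)

text \<open>The underlying real inner product. For self-adjoint operators, real quadratic forms suffice to
express the order.\<close>

definition ip :: "'h::complex_hilbert_space \<Rightarrow> 'h \<Rightarrow> real" where
  "ip \<xi> \<eta> = Re (cinner \<xi> \<eta>)"

lemma ip_commute: "ip \<xi> \<eta> = ip \<eta> \<xi>"
  unfolding ip_def by (subst cinner_commute) simp

lemma ip_add_right: "ip \<xi> (\<eta> + \<zeta>) = ip \<xi> \<eta> + ip \<xi> \<zeta>"
  by (simp add: ip_def cinner_add_right)

lemma ip_scaleR_right: "ip \<xi> (r *\<^sub>R \<eta>) = r * ip \<xi> \<eta>"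
  using cinner_scaleC_right[of \<xi> "complex_of_real r" \<eta>] by (simp add: ip_def scaleC_of_real)

lemma ip_self: "ip \<xi> \<xi> = (norm \<xi>)\<^sup>2"
  by (simp add: ip_def cinner_self)

lemma ip_add_left: "ip (\<xi> + \<eta>) \<zeta> = ip \<xi> \<zeta> + ip \<eta> \<zeta>"
  using ip_add_right[of \<zeta> \<xi> \<eta>] by (simp add: ip_commute)

lemma ip_scaleR_left: "ip (r *\<^sub>R \<xi>) \<eta> = r * ip \<xi> \<eta>"
  using ip_scaleR_right[of \<eta> r \<xi>] by (simp add: ip_commute)

lemma ip_minus_left: "ip (- \<xi>) \<eta> = - ip \<xi> \<eta>"
  using ip_scaleR_left[of "-1" \<xi> \<eta>] by simp

lemma ip_minus_right: "ip \<xi> (- \<eta>) = - ip \<xi> \<eta>"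
  using ip_scaleR_right[of \<xi> "-1" \<eta>] by simp

lemma ip_diff_left: "ip (\<xi> - \<eta>) \<zeta> = ip \<xi> \<zeta> - ip \<eta> \<zeta>"
  using ip_add_left[of \<xi> "- \<eta>" \<zeta>] by (simp add: ip_minus_left)

lemma ip_diff_right: "ip \<xi> (\<eta> - \<zeta>) = ip \<xi> \<eta> - ip \<xi> \<zeta>"
  using ip_add_right[of \<xi> \<eta> "- \<zeta>"] by (simp add: ip_minus_right)

lemmas ip_simps = ip_add_left ip_add_right ip_diff_left ip_diff_right ip_scaleR_left
  ip_scaleR_right ip_minus_left ip_minus_right

lemma ip_le: "\<bar>ip \<xi> \<eta>\<bar> \<le> norm \<xi> * norm \<eta>"
proof -
  have le: "ip \<xi> \<eta> \<le> norm \<xi> * norm \<eta>" for \<xi> \<eta> :: 'a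
  proof -
    have "(norm (\<xi> + \<eta>))\<^sup>2 \<le> (norm \<xi> + norm \<eta>)\<^sup>2"
      by (intro power_mono norm_triangle_ineq) auto
    then have "2 * ip \<xi> \<eta> \<le> 2 * (norm \<xi> * norm \<eta>)"
      using ip_commute[of \<xi> \<eta>] by (simp add: ip_simps power2_sum flip: ip_self)
    then show ?thesis by simp
  qed
  show ?thesis using le[of \<xi> \<eta>] le[of "- \<xi>" \<eta>] by (simp add: ip_minus_left)
qed

lemma bounded_bilinear_ip: "bounded_bilinear ip"
  by (standard, simp_all add: ip_simps)
    (intro exI[of _ 1], use ip_le in auto)

lemmas tendsto_ip [tendsto_intros] = bounded_bilinear.tendsto[OF bounded_bilinear_ip]
lemmas continuous_on_ip [continuous_intros] = bounded_bilinear.continuous_on[OF bounded_bilinear_ip]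

lemma ip_eqI: "(\<And>\<zeta>. ip \<xi> \<zeta> = ip \<eta> \<zeta>) \<Longrightarrow> \<xi> = \<eta>"
  using ip_self[of "\<xi> - \<eta>"] by (simp add: ip_simps)

lemma parallelogram: "(norm (\<xi> + \<eta>))\<^sup>2 + (norm (\<xi> - \<eta>))\<^sup>2 = 2 * (norm \<xi>)\<^sup>2 + 2 * (norm (\<eta>::'h::complex_hilbert_space))\<^sup>2"
  by (simp add: ip_simps flip: ip_self)

text \<open>Polarisation, applied to \<open>\<xi>\<close> and the multiple of \<open>T \<xi>\<close> that has the same norm as \<open>\<xi>\<close>.\<close>

lemma form_bound_imp_norm_bound:
  fixes T :: "'h::complex_hilbert_space \<Rightarrow>\<^sub>L 'h"
  assumes sym: "\<And>\<xi> \<eta>. ip (T \<xi>) \<eta> = ip \<xi> (T \<eta>)" and c: "0 \<le> c"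
    and bound: "\<And>\<xi>. \<bar>ip (T \<xi>) \<xi>\<bar> \<le> c * (norm \<xi>)\<^sup>2"
  shows "norm (T \<xi>) \<le> c * norm \<xi>"
proof (cases "T \<xi> = 0")
  case True then show ?thesis using c by simp
next
  case False
  then have N: "0 < norm (T \<xi>)" by simp
  have M: "0 < norm \<xi>" using False by (metis blinfun.zero_right zero_less_norm_iff)
  define \<eta> where "\<eta> = (norm \<xi> / norm (T \<xi>)) *\<^sub>R T \<xi>"
  have n\<eta>: "norm \<eta> = norm \<xi>" using N by (simp add: \<eta>_def)
  have "4 * ip (T \<xi>) \<eta> = ip (T (\<xi> + \<eta>)) (\<xi> + \<eta>) - ip (T (\<xi> - \<eta>)) (\<xi> - \<eta>)"
    using sym[of \<eta> \<xi>] ip_commute[of \<eta> "T \<xi>"] by (simp add: ip_simps blinfun.add_right blinfun.diff_right)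
  also have "\<dots> \<le> c * (norm (\<xi> + \<eta>))\<^sup>2 + c * (norm (\<xi> - \<eta>))\<^sup>2"
    using bound[of "\<xi> + \<eta>"] bound[of "\<xi> - \<eta>"] by linarith
  also have "\<dots> = c * (4 * (norm \<xi>)\<^sup>2)"
    unfolding distrib_left[symmetric] parallelogram n\<eta> by simp
  finally have "ip (T \<xi>) \<eta> \<le> c * (norm \<xi>)\<^sup>2" by simp
  moreover have "ip (T \<xi>) \<eta> = norm \<xi> * norm (T \<xi>)"
    using N by (simp add: \<eta>_def ip_simps ip_self power2_eq_square)
  ultimately have "norm \<xi> * norm (T \<xi>) \<le> norm \<xi> * (c * norm \<xi>)"
    by (simp add: power2_eq_square mult_ac)
  then show ?thesis using M by simp
qed

lemma le_zero_of_all_eps: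
  fixes a b :: real
  assumes "\<And>\<epsilon>. \<epsilon> > 0 \<Longrightarrow> 0 \<le> a + \<epsilon> * b"
  shows "0 \<le> a"
proof -
  have "(\<lambda>n. a + inverse (real (Suc n)) * b) \<longlonglongrightarrow> a + 0 * b"
    by (intro tendsto_intros LIMSEQ_inverse_real_of_nat)
  then have "0 \<le> a + 0 * b"
    by (rule LIMSEQ_le_const) (intro exI[of _ 0] allI impI assms, simp)
  then show ?thesis by simp
qed

text \<open>Order relations are read off from the quadratic forms of the represented operators, while elements
stay in the abstract algebra, on which the conjugation of a real form acts.\<close>

locale concrete_von_neumann_algebra =
  fixes \<pi> :: "'a::unital_cstar_algebra \<Rightarrow> ('h::complex_hilbert_space \<Rightarrow>\<^sub>L 'h)"
  assumes rep: "unital_star_representation \<pi>" and inj: "inj \<pi>"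
    and closed_range: "closedin strong_operator_topology (range \<pi>)"
begin

lemma rep_add: "\<pi> (a + b) = \<pi> a + \<pi> b"
  using rep by (simp add: unital_star_representation_def)

lemma rep_scaleC: "\<pi> (c *\<^sub>C a) \<xi> = c *\<^sub>C \<pi> a \<xi>"
  using rep by (simp add: unital_star_representation_def)

lemma rep_scaleR: "\<pi> (r *\<^sub>R a) = r *\<^sub>R \<pi> a"
  using rep_scaleC[of "complex_of_real r" a]
  by (intro blinfun_eqI) (simp add: scaleC_of_real blinfun.scaleR_left)

lemma rep_mult: "\<pi> (a * b) = \<pi> a o\<^sub>L \<pi> b"
  using rep by (simp add: unital_star_representation_def)

lemma rep_one: "\<pi> 1 = id_blinfun"
  using rep by (simp add: unital_star_representation_def)

lemma rep_zero: "\<pi> 0 = 0"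
  using rep_scaleR[of 0 0] by simp

lemma rep_minus: "\<pi> (- a) = - \<pi> a"
  using rep_scaleR[of "-1" a] by simp

lemma rep_diff: "\<pi> (a - b) = \<pi> a - \<pi> b"
  using rep_add[of a "- b"] by (simp add: rep_minus)

lemma rep_adjoint: "ip (\<pi> (star a) \<xi>) \<eta> = ip \<xi> (\<pi> a \<eta>)"
  using rep by (simp add: unital_star_representation_def ip_def)

lemmas rep_simps = rep_add rep_diff rep_minus rep_scaleR rep_mult rep_one rep_zero
  blinfun.add_left blinfun.diff_left blinfun.minus_left blinfun.scaleR_left

lemma rep_sym: "star a = a \<Longrightarrow> ip (\<pi> a \<xi>) \<eta> = ip \<xi> (\<pi> a \<eta>)"
  using rep_adjoint[of a \<xi> \<eta>] by simp

lemma rep_eqI: "(\<And>\<xi>. \<pi> a \<xi> = \<pi> b \<xi>) \<Longrightarrow> a = b"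
  using inj by (metis blinfun_eqI injD)

lemma star_eqI: "(\<And>\<xi> \<eta>. ip (\<pi> a \<xi>) \<eta> = ip \<xi> (\<pi> a \<eta>)) \<Longrightarrow> star a = a"
  by (intro rep_eqI ip_eqI) (simp add: rep_adjoint)

definition pos :: "'a \<Rightarrow> bool" where
  "pos a \<longleftrightarrow> star a = a \<and> (\<forall>\<xi>. 0 \<le> ip (\<pi> a \<xi>) \<xi>)"

lemma pos_star: "pos a \<Longrightarrow> star a = a" and pos_form: "pos a \<Longrightarrow> 0 \<le> ip (\<pi> a \<xi>) \<xi>"
  by (auto simp: pos_def)

lemma pos_add: "pos a \<Longrightarrow> pos b \<Longrightarrow> pos (a + b)"
  by (simp add: pos_def star_add rep_simps ip_simps)

lemma pos_scaleR: "pos a \<Longrightarrow> 0 \<le> r \<Longrightarrow> pos (r *\<^sub>R a)"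
  by (simp add: pos_def star_scaleR rep_simps ip_simps)

lemma pos_conj: "pos a \<Longrightarrow> pos (star c * a * c)"
  by (simp add: pos_def star_simps rep_simps rep_adjoint mult.assoc)

lemma pos_one: "pos 1"
  by (simp add: pos_def star_one rep_simps ip_self)

lemma pos_square: "star s = s \<Longrightarrow> pos (s * s)"
  using pos_conj[OF pos_one, of s] by simp

lemma pos_antisym:
  assumes "pos a" "pos (- a)" shows "a = 0"
proof -
  have "ip (\<pi> a \<xi>) \<xi> = 0" for \<xi>
    using pos_form[OF assms(1), of \<xi>] pos_form[OF assms(2), of \<xi>] by (simp add: rep_simps ip_simps)
  then have "norm (\<pi> a \<xi>) \<le> 0 * norm \<xi>" for \<xi>
    using assms by (intro form_bound_imp_norm_bound rep_sym pos_star) auto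
  then show ?thesis by (intro rep_eqI) (simp add: rep_zero)
qed

lemma norm_rep_le:
  assumes a: "star a = a" and c: "0 \<le> c" and b: "pos (c *\<^sub>R 1 - a)" "pos (c *\<^sub>R 1 + a)"
  shows "norm (\<pi> a \<xi>) \<le> c * norm \<xi>"
proof (rule form_bound_imp_norm_bound[OF rep_sym[OF a] c])
  fix \<xi>
  show "\<bar>ip (\<pi> a \<xi>) \<xi>\<bar> \<le> c * (norm \<xi>)\<^sup>2"
    using pos_form[OF b(1), of \<xi>] pos_form[OF b(2), of \<xi>]
    by (simp add: rep_simps ip_simps ip_self abs_le_iff)
qed

lemma closed_range_norm: "closed (range \<pi>)"
  using closedin_continuous_map_preimage[OF strong_operator_topology_weaker_than_euclidean closed_range]
  by simp

text \<open>After scaling, \<open>(a + \<epsilon>) / C\<close> is \<open>1 - b\<close> with \<open>0 \<le> b \<le> 1 - \<epsilon> / C\<close>, so the operator norm of \<open>b\<close> is less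
than \<open>1\<close> and \<open>square_root_iteration\<close> applies in the range of the representation, which is closed in
operator norm. The shift by \<open>\<epsilon>\<close> is what makes the iteration contract. The iteration uses the
operator norm since at this stage the norm of the algebra is not known to be controlled by the order.\<close>

lemma ex_sqrt:
  assumes a: "pos a" and e: "0 < \<epsilon>"
  shows "\<exists>s. star s = s \<and> s * s = a + \<epsilon> *\<^sub>R 1 \<and> (\<forall>z. z * a = a * z \<longrightarrow> z * s = s * z)"
proof -
  define C where "C = norm (\<pi> a) + \<epsilon>"
  have C: "0 < C" "\<epsilon> \<le> C" using e by (simp_all add: C_def add_nonneg_pos)
  define b where "b = 1 - (1 / C) *\<^sub>R (a + \<epsilon> *\<^sub>R 1)"
  have star_b: "star b = b" using pos_star[OF a] by (simp add: b_def star_simps)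
  have pos_b: "pos b"
    unfolding pos_def
  proof (intro conjI star_b allI)
    fix \<xi>
    have "ip (\<pi> a \<xi>) \<xi> \<le> norm (\<pi> a) * norm \<xi> * norm \<xi>"
      using ip_le[of "\<pi> a \<xi>" \<xi>] mult_right_mono[OF norm_blinfun[of "\<pi> a" \<xi>] norm_ge_zero[of \<xi>]]
      by linarith
    then have "ip (\<pi> a \<xi>) \<xi> + \<epsilon> * (norm \<xi>)\<^sup>2 \<le> C * (norm \<xi>)\<^sup>2"
      by (simp add: C_def power2_eq_square algebra_simps)
    then show "0 \<le> ip (\<pi> b \<xi>) \<xi>"
      using C by (simp add: b_def rep_simps ip_simps ip_self divide_le_eq add_divide_distrib[symmetric] mult.commute)
  qed
  define q where "q = 1 - \<epsilon> / C"
  have q: "0 \<le> q" "q < 1" using C e by (simp_all add: q_def)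
  have "q *\<^sub>R 1 - b = (1 / C) *\<^sub>R a"
    by (simp add: q_def b_def algebra_simps)
  then have "pos (q *\<^sub>R 1 - b)" using pos_scaleR[OF a, of "1 / C"] C by simp
  moreover have "pos (q *\<^sub>R 1 + b)" by (intro pos_add pos_scaleR pos_one pos_b q)
  ultimately have "norm (\<pi> b \<xi>) \<le> q * norm \<xi>" for \<xi>
    by (intro norm_rep_le star_b q)
  then have "norm (\<pi> b) \<le> q" by (intro norm_blinfun_bound q) (simp add: mult.commute)
  then have nb: "norm (\<pi> b) < 1" using q by simp
  \<comment> \<open>Each condition is tested on vectors, so that it is closed in operator norm; together they describe
  the elements that \<open>inS\<close> and \<open>Sout\<close> identify.\<close>
  define S where "S = range \<pi> \<inter> (\<Inter>\<xi>. \<Inter>\<eta>. {W. ip (blinfun_apply W \<xi>) \<eta> = ip \<xi> (blinfun_apply W \<eta>)})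
    \<inter> (\<Inter>z\<in>{z. z * a = a * z}. \<Inter>\<xi>. {W. blinfun_apply (\<pi> z) (blinfun_apply W \<xi>) = blinfun_apply W (blinfun_apply (\<pi> z) \<xi>)})"
  have closedS: "closed S"
    unfolding S_def
    by (intro closed_Int closed_INT ballI closed_range_norm closed_Collect_eq continuous_intros)
  have inS: "\<pi> w \<in> S" if "star w = w" "\<And>z. z * a = a * z \<Longrightarrow> z * w = w * z" for w
  proof -
    have "\<pi> z (\<pi> w \<xi>) = \<pi> w (\<pi> z \<xi>)" if "z * a = a * z" for z \<xi>
      using \<open>\<And>z. z * a = a * z \<Longrightarrow> z * w = w * z\<close>[OF that]
      by (metis rep_mult blinfun_apply_blinfun_compose)
    then show ?thesis using rep_sym[OF that(1)] by (auto simp: S_def)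
  qed
  have Sout: "\<exists>w. W = \<pi> w \<and> star w = w \<and> (\<forall>z. z * a = a * z \<longrightarrow> z * w = w * z)" if "W \<in> S" for W
  proof -
    obtain w where w: "W = \<pi> w" using \<open>W \<in> S\<close> by (auto simp: S_def)
    have "star w = w" using \<open>W \<in> S\<close> by (intro star_eqI) (auto simp: S_def w)
    moreover have "z * w = w * z" if "z * a = a * z" for z
      using \<open>W \<in> S\<close> that by (intro rep_eqI) (auto simp: S_def w rep_mult)
    ultimately show ?thesis using w by blast
  qed
  have comm_b: "z * b = b * z" if "z * a = a * z" for z
    using that by (simp add: b_def algebra_simps)
  have "\<exists>W\<in>S. 2 *\<^sub>R W = \<pi> b + (W o\<^sub>L W)"
  proof (rule square_root_iteration[OF bounded_bilinear_blinfun_compose norm_blinfun_compose nb closedS])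
    have "\<pi> 0 \<in> S" by (intro inS) (auto simp: star_zero)
    then show "0 \<in> S" by (simp add: rep_zero)
    fix W assume "W \<in> S"
    then obtain w where w: "W = \<pi> w" "star w = w" "\<And>z. z * a = a * z \<Longrightarrow> z * w = w * z"
      using Sout by blast
    have "\<pi> ((1/2) *\<^sub>R (b + w * w)) \<in> S"
    proof (rule inS)
      show "star ((1/2) *\<^sub>R (b + w * w)) = (1/2) *\<^sub>R (b + w * w)"
        by (simp add: star_simps star_b w(2))
      fix z assume z: "z * a = a * z"
      have "z * (w * w) = w * w * z" using w(3)[OF z] by (metis mult.assoc)
      then show "z * ((1/2) *\<^sub>R (b + w * w)) = (1/2) *\<^sub>R (b + w * w) * z"
        using comm_b[OF z] by (simp add: distrib_left distrib_right)
    qed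
    then show "(1/2) *\<^sub>R (\<pi> b + (W o\<^sub>L W)) \<in> S"
      by (simp add: w(1) rep_add rep_scaleR rep_mult)
  qed
  then obtain w where w: "2 *\<^sub>R \<pi> w = \<pi> b + (\<pi> w o\<^sub>L \<pi> w)" "star w = w"
      "\<And>z. z * a = a * z \<Longrightarrow> z * w = w * z"
    using Sout by metis
  have "\<pi> (2 *\<^sub>R w) = \<pi> (b + w * w)" using w(1) by (simp add: rep_add rep_scaleR rep_mult)
  then have bw: "w + w = b + w * w" using inj by (simp add: injD scaleR_2)
  define s where "s = sqrt C *\<^sub>R (1 - w)"
  have "s * s = C *\<^sub>R ((1 - w) * (1 - w))" using C by (simp add: s_def)
  also have "(1 - w) * (1 - w) = 1 - b" using bw by (simp add: algebra_simps)
  also have "C *\<^sub>R (1 - b) = a + \<epsilon> *\<^sub>R 1" using C by (simp add: b_def)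
  finally have "s * s = a + \<epsilon> *\<^sub>R 1" .
  moreover have "star s = s" by (simp add: s_def star_simps w(2))
  moreover have "z * s = s * z" if "z * a = a * z" for z
    using w(3)[OF that] by (simp add: s_def algebra_simps)
  ultimately show ?thesis by blast
qed

text \<open>If \<open>s\<close> is a square root of \<open>a + \<epsilon>\<close> that commutes with \<open>b\<close>, then \<open>(a + \<epsilon>) b = s b s\<close>.\<close>

lemma pos_mult:
  assumes a: "pos a" and b: "pos b" and comm: "a * b = b * a"
  shows "pos (a * b)"
  unfolding pos_def
proof (intro conjI allI)
  show "star (a * b) = a * b" using pos_star[OF a] pos_star[OF b] comm by (simp add: star_mult)
  fix \<xi>
  show "0 \<le> ip (\<pi> (a * b) \<xi>) \<xi>"
  proof (rule le_zero_of_all_eps)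
    fix \<epsilon> :: real assume "0 < \<epsilon>"
    then obtain s where s: "star s = s" "s * s = a + \<epsilon> *\<^sub>R 1" "\<And>z. z * a = a * z \<Longrightarrow> z * s = s * z"
      using ex_sqrt[OF a] by blast
    have "star s * b * s = (a + \<epsilon> *\<^sub>R 1) * b"
      using s(3)[of b] comm s(1,2) by (metis mult.assoc)
    then have "pos ((a + \<epsilon> *\<^sub>R 1) * b)" using pos_conj[OF b, of s] by simp
    then show "0 \<le> ip (\<pi> (a * b) \<xi>) \<xi> + \<epsilon> * ip (\<pi> b \<xi>) \<xi>"
      using pos_form[of "(a + \<epsilon> *\<^sub>R 1) * b" \<xi>] by (simp add: distrib_right rep_simps ip_simps)
  qed
qed

text \<open>The order controls the norm of the algebra: \<open>h\<close> is the real part of \<open>u = h + \<i> s\<close> with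
\<open>s\<^sup>2 = 1 - h\<^sup>2 + \<epsilon>\<close>, and \<open>star u * u = 1 + \<epsilon>\<close> by commutativity, which the C*-identity turns into a
bound for \<open>u\<close>.\<close>

lemma norm_le_one_of_order:
  assumes h: "star h = h" and b: "pos (1 - h)" "pos (1 + h)"
  shows "norm h \<le> 1"
proof -
  have "(1 - h) * (1 + h) = 1 - h * h" "(1 + h) * (1 - h) = 1 - h * h" by (simp_all add: algebra_simps)
  then have p: "pos (1 - h * h)" using pos_mult[OF b] by simp
  have "0 \<le> (1 - (norm h)\<^sup>2) + \<epsilon> * 1" if e: "0 < \<epsilon>" for \<epsilon>
  proof -
    obtain s where s: "star s = s" "s * s = (1 - h * h) + \<epsilon> *\<^sub>R 1"
        "\<And>z. z * (1 - h * h) = (1 - h * h) * z \<Longrightarrow> z * s = s * z"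
      using ex_sqrt[OF p e] by blast
    have hs: "h * s = s * h" by (rule s(3)) (simp add: algebra_simps)
    define u where "u = h + \<i> *\<^sub>C s"
    have su: "star u = h - \<i> *\<^sub>C s" by (simp add: u_def star_simps h s(1) scaleC_minus_left)
    have "star u * u = h * h - \<i> *\<^sub>C \<i> *\<^sub>C (s * s)"
      unfolding su unfolding u_def
      by (simp add: algebra_simps scaleC_mult_left scaleC_mult_right scaleC_diff_right hs)
    also have "\<dots> = (1 + \<epsilon>) *\<^sub>R 1" by (simp add: scaleC_ii_ii s(2) scaleR_add_left)
    finally have "(norm u)\<^sup>2 \<le> 1 + \<epsilon>"
      using cstar_identity[of u] mult_left_le[OF norm_one_le[where 'a='a], of "1 + \<epsilon>"] e
      by simp
    moreover have "2 *\<^sub>R h = u + star u" by (simp add: su) (simp add: u_def scaleR_2)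
    then have "2 * norm h \<le> norm u + norm (star u)"
      using norm_triangle_ineq[of u "star u"] by (metis abs_numeral norm_scaleR)
    then have "norm h \<le> norm u" by (simp add: norm_star)
    then have "(norm h)\<^sup>2 \<le> (norm u)\<^sup>2" by (intro power_mono) auto
    ultimately show ?thesis by linarith
  qed
  then have "0 \<le> 1 - (norm h)\<^sup>2" by (rule le_zero_of_all_eps)
  then show ?thesis using abs_square_le_1[of "norm h"] by simp
qed

text \<open>Conversely, \<open>\<i> h\<close> is an average of two unitaries, which are represented by isometries.\<close>

lemma order_of_norm_less_one:
  assumes h: "star h = h" "norm h < 1"
  shows "pos (1 - h)" "pos (1 + h)"
proof -
  interpret closed_real_star_subalgebra "UNIV :: 'a set" by standard auto
  have "\<exists>u\<in>UNIV. unitary u \<and> \<i> *\<^sub>C h = (1/2) *\<^sub>R (u - star u)"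
    using h by (intro skew_eq_unitary_difference) (auto simp: star_simps scaleC_minus_left norm_scaleC)
  then obtain u where u: "unitary u" "\<i> *\<^sub>C h = (1/2) *\<^sub>R (u - star u)" by blast
  have nu: "norm (\<pi> v \<xi>) = norm \<xi>" if "unitary v" for v \<xi>
  proof -
    have "(norm (\<pi> v \<xi>))\<^sup>2 = ip (\<pi> (star v * v) \<xi>) \<xi>"
      by (simp add: rep_mult rep_adjoint ip_self)
    also have "\<dots> = (norm \<xi>)\<^sup>2" using that by (simp add: unitary_def rep_one ip_self)
    finally show ?thesis by simp
  qed
  have "norm (\<pi> h \<xi>) \<le> norm \<xi>" for \<xi>
  proof -
    have "norm (\<pi> h \<xi>) = norm (\<pi> (\<i> *\<^sub>C h) \<xi>)" by (simp add: rep_scaleC norm_scaleC)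
    also have "\<dots> = (1/2) * norm (\<pi> u \<xi> - \<pi> (star u) \<xi>)" unfolding u(2) by (simp add: rep_simps flip: scaleR_diff_right)
    also have "\<dots> \<le> (1/2) * (norm \<xi> + norm \<xi>)"
      using norm_triangle_ineq4[of "\<pi> u \<xi>" "\<pi> (star u) \<xi>"] nu[OF u(1)] nu[OF unitary_star[OF u(1)]] by simp
    finally show ?thesis by simp
  qed
  then have le: "\<bar>ip (\<pi> h \<xi>) \<xi>\<bar> \<le> norm \<xi> * norm \<xi>" for \<xi>
    using ip_le[of "\<pi> h \<xi>" \<xi>] mult_right_mono[of "norm (\<pi> h \<xi>)" "norm \<xi>" "norm \<xi>"]
    by (meson norm_ge_zero order_trans)
  have "0 \<le> ip (\<pi> (1 - h) \<xi>) \<xi>" "0 \<le> ip (\<pi> (1 + h) \<xi>) \<xi>" for \<xi>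
    using le[of \<xi>] unfolding abs_le_iff
    by (simp_all add: rep_simps ip_simps ip_self power2_eq_square)
  then show "pos (1 - h)" "pos (1 + h)"
    using h(1) by (simp_all add: pos_def star_simps)
qed

end

section \<open>Monotone limits\<close>

context concrete_von_neumann_algebra
begin

text \<open>For an increment \<open>d\<close> with \<open>0 \<le> d \<le> 2\<close> the product \<open>d (2 - d)\<close> is positive, that is \<open>d\<^sup>2 \<le> 2 d\<close>, so the
squared norm of \<open>d \<xi>\<close> is at most twice the increment of the quadratic forms at \<open>\<xi>\<close>, which increase
and are bounded.\<close>

lemma monotone_bounded_Cauchy:
  assumes star: "\<And>n. star (h n) = h n" and mono: "\<And>n. pos (h (Suc n) - h n)"
    and bounds: "\<And>n. pos (1 - h n)" "\<And>n. pos (1 + h n)"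
  shows "Cauchy (\<lambda>n. \<pi> (h n) \<xi>)"
proof -
  define a where "a n = ip (\<pi> (h n) \<xi>) \<xi>" for n
  have pos_diff: "pos (h (n + k) - h n)" for n k
  proof (induction k)
    case 0
    show ?case using pos_scaleR[OF pos_one, of 0] by simp
  next
    case (Suc k)
    show ?case using pos_add[OF mono[of "n + k"] Suc] by simp
  qed
  have key: "(norm (\<pi> (h (n + k)) \<xi> - \<pi> (h n) \<xi>))\<^sup>2 \<le> 2 * (a (n + k) - a n)" for n k
  proof -
    define d where "d = h (n + k) - h n"
    have d: "pos d" "star d = d" using pos_diff pos_star by (auto simp: d_def)
    have "2 *\<^sub>R 1 - d = (1 - h (n + k)) + (1 + h n)" by (simp add: d_def scaleR_2)
    then have "pos (2 *\<^sub>R 1 - d)" using pos_add[OF bounds] by simp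
    then have "pos (d * (2 *\<^sub>R 1 - d))"
      by (intro pos_mult d(1)) (simp_all add: algebra_simps)
    moreover have "d * (2 *\<^sub>R 1 - d) = 2 *\<^sub>R d - d * d" by (simp add: right_diff_distrib)
    ultimately have "0 \<le> ip (\<pi> (2 *\<^sub>R d - d * d) \<xi>) \<xi>" using pos_form by simp
    also have "\<dots> = 2 * ip (\<pi> d \<xi>) \<xi> - (norm (\<pi> d \<xi>))\<^sup>2"
      using rep_sym[OF d(2), of "\<pi> d \<xi>" \<xi>] by (simp add: rep_simps ip_simps ip_self)
    finally show ?thesis by (simp add: d_def rep_simps ip_simps a_def)
  qed
  have "incseq a"
    using pos_form[OF mono, of _ \<xi>] by (intro incseq_SucI) (simp add: a_def rep_simps ip_simps)
  moreover have "a n \<le> (norm \<xi>)\<^sup>2" for n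
    using pos_form[OF bounds(1), of n \<xi>] by (simp add: a_def rep_simps ip_simps ip_self)
  ultimately have "convergent a"
    by (meson incseq_convergent convergentI)
  then have "Cauchy a" by (rule convergent_Cauchy)
  show ?thesis
  proof (rule CauchyI')
    fix e :: real assume e: "0 < e"
    then obtain M where M: "\<And>m n. m \<ge> M \<Longrightarrow> n \<ge> M \<Longrightarrow> dist (a m) (a n) < e\<^sup>2 / 2"
      using \<open>Cauchy a\<close> unfolding Cauchy_def by (metis half_gt_zero zero_less_power)
    have "dist (\<pi> (h m) \<xi>) (\<pi> (h n) \<xi>) < e" if "m \<ge> M" "n > m" for m n
    proof -
      obtain k where k: "n = m + k" using \<open>n > m\<close> by (metis less_imp_add_positive)
      have "(norm (\<pi> (h n) \<xi> - \<pi> (h m) \<xi>))\<^sup>2 < e\<^sup>2"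
        using key[of m k] M[of n m] that unfolding k dist_real_def abs_less_iff right_diff_distrib by linarith
      then show ?thesis using e by (simp add: dist_norm norm_minus_commute power_less_imp_less_base)
    qed
    then show "\<exists>M. \<forall>m\<ge>M. \<forall>n>m. dist (\<pi> (h m) \<xi>) (\<pi> (h n) \<xi>) < e" by blast
  qed
qed

lemma norm_rep_le_one:
  assumes "star a = a" "pos (1 - a)" "pos (1 + a)"
  shows "norm (\<pi> a \<xi>) \<le> norm \<xi>"
  using norm_rep_le[of a 1 \<xi>] assms by simp

text \<open>The pointwise limit is a bounded operator and a strong limit of elements of the range of \<open>\<pi>\<close>; this is
where strong closedness is used.\<close>

lemma monotone_strong_limit:
  assumes star: "\<And>n. star (h n) = h n" and mono: "\<And>n. pos (h (Suc n) - h n)"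
    and bounds: "\<And>n. pos (1 - h n)" "\<And>n. pos (1 + h n)"
  shows "\<exists>p. star p = p \<and> (\<forall>\<xi>. (\<lambda>n. \<pi> (h n) \<xi>) \<longlonglongrightarrow> \<pi> p \<xi>)"
proof -
  define P where "P \<xi> = lim (\<lambda>n. \<pi> (h n) \<xi>)" for \<xi>
  have P: "(\<lambda>n. \<pi> (h n) \<xi>) \<longlonglongrightarrow> P \<xi>" for \<xi>
    using monotone_bounded_Cauchy[of h \<xi>, OF star mono bounds] unfolding P_def
    using Cauchy_convergent convergent_LIMSEQ_iff by blast
  have "bounded_linear P"
  proof (rule bounded_linear_intro[of _ 1])
    fix \<xi> \<eta> and r :: real
    have "(\<lambda>n. \<pi> (h n) (\<xi> + \<eta>)) \<longlonglongrightarrow> P \<xi> + P \<eta>"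
      unfolding blinfun.add_right by (intro tendsto_intros P)
    then show "P (\<xi> + \<eta>) = P \<xi> + P \<eta>" using P LIMSEQ_unique by blast
    have "(\<lambda>n. \<pi> (h n) (r *\<^sub>R \<xi>)) \<longlonglongrightarrow> r *\<^sub>R P \<xi>"
      unfolding blinfun.scaleR_right by (intro tendsto_intros P)
    then show "P (r *\<^sub>R \<xi>) = r *\<^sub>R P \<xi>" using P LIMSEQ_unique by blast
    have "norm (P \<xi>) \<le> norm \<xi>"
      by (rule LIMSEQ_le_const2[OF tendsto_norm[OF P]])
        (use norm_rep_le_one star bounds in blast)
    then show "norm (P \<xi>) \<le> norm \<xi> * 1" by simp
  qed
  then have B: "blinfun_apply (Blinfun P) = P" by (rule bounded_linear_Blinfun_apply)
  have "Blinfun P \<in> range \<pi>"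
    by (rule strong_limit_in_closedin[OF closed_range, of "\<lambda>n. \<pi> (h n)"]) (simp_all add: B P)
  then obtain p where p: "\<pi> p = Blinfun P" by (metis imageE)
  then have lim: "(\<lambda>n. \<pi> (h n) \<xi>) \<longlonglongrightarrow> \<pi> p \<xi>" for \<xi> using P by (simp add: B)
  have "star p = p"
  proof (rule star_eqI)
    fix \<xi> \<eta>
    have "(\<lambda>n. ip (\<pi> (h n) \<xi>) \<eta>) \<longlonglongrightarrow> ip (\<pi> p \<xi>) \<eta>" by (intro tendsto_intros lim)
    moreover have "(\<lambda>n. ip (\<pi> (h n) \<xi>) \<eta>) \<longlonglongrightarrow> ip \<xi> (\<pi> p \<eta>)"
      unfolding rep_sym[OF star] by (intro tendsto_intros lim)
    ultimately show "ip (\<pi> p \<xi>) \<eta> = ip \<xi> (\<pi> p \<eta>)" by (rule LIMSEQ_unique)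
  qed
  then show ?thesis using lim by blast
qed

lemma pos_strong_limit:
  assumes lim: "\<And>\<xi>. (\<lambda>n. \<pi> (h n) \<xi>) \<longlonglongrightarrow> \<pi> p \<xi>" and star: "star p = p"
    and ev: "\<And>n. N \<le> n \<Longrightarrow> pos (h n)"
  shows "pos p"
  unfolding pos_def
proof (intro conjI star allI)
  fix \<xi>
  have "(\<lambda>n. ip (\<pi> (h n) \<xi>) \<xi>) \<longlonglongrightarrow> ip (\<pi> p \<xi>) \<xi>" by (intro tendsto_intros lim)
  then show "0 \<le> ip (\<pi> p \<xi>) \<xi>"
    by (rule LIMSEQ_le_const) (use ev pos_form in blast)
qed

text \<open>Joint continuity of evaluation on bounded sets, needed because multiplication is not jointly
continuous in the strong topology.\<close>

lemma strong_limit_apply: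
  assumes lim: "\<And>\<xi>. (\<lambda>n. \<pi> (h n) \<xi>) \<longlonglongrightarrow> \<pi> p \<xi>"
    and bound: "\<And>n \<xi>. norm (\<pi> (h n) \<xi>) \<le> norm \<xi>" and \<eta>: "\<eta> \<longlonglongrightarrow> \<eta>'"
  shows "(\<lambda>n. \<pi> (h n) (\<eta> n)) \<longlonglongrightarrow> \<pi> p \<eta>'"
proof -
  have "(\<lambda>n. norm (\<eta> n - \<eta>')) \<longlonglongrightarrow> 0"
    using \<eta> by (simp add: LIM_zero tendsto_norm_zero)
  then have "(\<lambda>n. \<pi> (h n) (\<eta> n - \<eta>')) \<longlonglongrightarrow> 0"
    by (rule Lim_null_comparison[rotated]) (simp add: bound)
  from tendsto_add[OF this lim[of \<eta>']] show ?thesis by (simp add: blinfun.diff_right)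
qed

end

section \<open>Spectral projections in the real part\<close>

text \<open>The map \<open>t \<mapsto> t + t\<^sup>2 (1 - t) / 2\<close> lowers no point of \<open>[-1, 1]\<close>, maps each of \<open>[-1, 0]\<close> and \<open>[0, 1]\<close> to
itself, and has only the fixed points \<open>0\<close> and \<open>1\<close>. So its iterates increase to the indicator
function of \<open>{0<..1}\<close>.\<close>

definition raise :: "'a::unital_cstar_algebra \<Rightarrow> 'a" where
  "raise g = g + (1/2) *\<^sub>R (g * g * (1 - g))"

text \<open>\<open>J\<close> is the conjugation of the complex algebra, regarded as a real-linear *-automorphism; its fixed
points are the real part.\<close>

locale real_part_of_von_neumann_algebra = concrete_von_neumann_algebra \<pi>
  for \<pi> :: "'a::unital_cstar_algebra \<Rightarrow> ('h::complex_hilbert_space \<Rightarrow>\<^sub>L 'h)" +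
  fixes J :: "'a \<Rightarrow> 'a"
  assumes J_add: "J (x + y) = J x + J y" and J_mult: "J (x * y) = J x * J y"
    and J_scaleR: "J (r *\<^sub>R x) = r *\<^sub>R J x" and J_star: "J (star x) = star (J x)"
    and J_one: "J 1 = 1" and J_J: "J (J x) = x"
begin

lemma J_minus: "J (- x) = - J x"
  using J_scaleR[of "-1" x] by simp

lemma J_diff: "J (x - y) = J x - J y"
  using J_add[of x "- y"] by (simp add: J_minus)

lemmas J_simps = J_add J_diff J_minus J_mult J_scaleR J_star J_one

text \<open>The order is determined algebraically: \<open>a\<close> is positive if and only if \<open>a + \<epsilon>\<close> is the square of a
self-adjoint element for every \<open>\<epsilon> > 0\<close>.\<close>

lemma pos_J: assumes a: "pos a" shows "pos (J a)"
  unfolding pos_def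
proof (intro conjI allI)
  show "star (J a) = J a" using pos_star[OF a] by (simp flip: J_star)
  fix \<xi>
  show "0 \<le> ip (\<pi> (J a) \<xi>) \<xi>"
  proof (rule le_zero_of_all_eps)
    fix \<epsilon> :: real assume "0 < \<epsilon>"
    then obtain s where s: "star s = s" "s * s = a + \<epsilon> *\<^sub>R 1" using ex_sqrt[OF a] by blast
    have "pos (J s * J s)" using s(1) by (intro pos_square) (simp flip: J_star)
    also have "J s * J s = J a + \<epsilon> *\<^sub>R 1" by (simp add: s(2) J_simps flip: J_mult)
    finally show "0 \<le> ip (\<pi> (J a) \<xi>) \<xi> + \<epsilon> * ip \<xi> \<xi>"
      using pos_form[of "J a + \<epsilon> *\<^sub>R 1" \<xi>] by (simp add: rep_simps ip_simps)
  qed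
qed

text \<open>Strong continuity of \<open>J\<close> is replaced by order: \<open>p\<close> is the least upper bound of the sequence, and
\<open>J\<close> maps it to another upper bound, so \<open>p \<le> J p\<close>; applying \<open>J\<close> once more gives \<open>J p \<le> p\<close>.\<close>

lemma J_fixes_monotone_limit:
  assumes lim: "\<And>\<xi>. (\<lambda>n. \<pi> (h n) \<xi>) \<longlonglongrightarrow> \<pi> p \<xi>" and star: "star p = p"
    and upper: "\<And>n. pos (p - h n)" and fixed: "\<And>n. J (h n) = h n"
  shows "J p = p"
proof -
  have "pos (J p - p)"
  proof (rule pos_strong_limit[of "\<lambda>n. J p - h n"])
    show "(\<lambda>n. \<pi> (J p - h n) \<xi>) \<longlonglongrightarrow> \<pi> (J p - p) \<xi>" for \<xi>
      unfolding rep_diff blinfun.diff_left by (intro tendsto_intros lim)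
    show "star (J p - p) = J p - p" by (simp add: star_diff star flip: J_star)
    show "pos (J p - h n)" for n using pos_J[OF upper[of n]] by (simp add: J_diff fixed)
  qed
  moreover have "pos (J (J p - p))" by (rule pos_J) fact
  then have "pos (- (J p - p))" by (simp add: J_diff J_J)
  ultimately have "J p - p = 0" by (rule pos_antisym)
  then show ?thesis by simp
qed

text \<open>Each inequality is the corresponding scalar one, with the polynomial factored so that positivity is
visible: \<open>raise g - g = g (1 - g) g / 2\<close>, then
\<open>1 - raise g = ((1 - g) + (1 - g) (1 + g) (1 - g)) / 2\<close>, and \<open>raise g = g k\<close> with
\<open>k = ((1 - g) (1 + g) + (1 + g)) / 2\<close>. Positivity of \<open>h g\<close> says that \<open>g\<close> keeps the sign of \<open>h\<close>.\<close>

lemma raise_invariants: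
  assumes star: "star g = g" and b: "pos (1 - g)" "pos (1 + g)" and J: "J g = g"
    and comm: "h * g = g * h" and hg: "pos (h * g)"
  shows "star (raise g) = raise g" "pos (1 - raise g)" "pos (1 + raise g)" "J (raise g) = raise g"
    "h * raise g = raise g * h" "pos (h * raise g)" "pos (raise g - g)"
proof -
  show "star (raise g) = raise g"
    by (simp add: raise_def star_simps star algebra_simps)
  have "pos ((1/2) *\<^sub>R (g * (1 - g) * g))"
    using pos_conj[OF b(1), of g] star by (intro pos_scaleR) auto
  moreover have "raise g - g = (1/2) *\<^sub>R (g * (1 - g) * g)"
    by (simp add: raise_def algebra_simps)
  ultimately show up: "pos (raise g - g)" by simp
  have "pos ((1/2) *\<^sub>R (1 - g) + (1/2) *\<^sub>R ((1 - g) * (1 + g) * (1 - g)))"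
    using pos_conj[OF b(2), of "1 - g"] b(1) star by (intro pos_add pos_scaleR) (auto simp: star_simps)
  moreover have "(1/2) *\<^sub>R (1 - g) + (1/2) *\<^sub>R ((1 - g) * (1 + g) * (1 - g)) = 1 - raise g"
  proof -
    have "(1 - g) + (1 - g) * (1 + g) * (1 - g) = 2 *\<^sub>R (1 - g) - g * g * (1 - g)"
      by (simp add: algebra_simps scaleR_2)
    then show ?thesis
      unfolding scaleR_add_right[symmetric] by (simp add: raise_def scaleR_diff_right)
  qed
  ultimately show "pos (1 - raise g)" by simp
  have "1 + raise g = (1 + g) + (raise g - g)" by simp
  then show "pos (1 + raise g)" using pos_add[OF b(2) up] by simp
  show "J (raise g) = raise g" by (simp add: raise_def J_simps J)
  define k where "k = 1 + (1/2) *\<^sub>R (g * (1 - g))"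
  have rk: "raise g = g * k" by (simp add: raise_def k_def distrib_left mult.assoc)
  have hk: "h * k = k * h"
  proof -
    have "h * (g * g) = g * g * h" using comm by (metis mult.assoc)
    then show ?thesis by (simp add: k_def algebra_simps comm)
  qed
  have gk: "g * k = k * g" by (simp add: k_def algebra_simps)
  show "h * raise g = raise g * h"
    unfolding rk using comm hk by (metis mult.assoc)
  have "pos ((1 - g) * (1 + g))" by (rule pos_mult[OF b]) (simp add: algebra_simps)
  then have "pos ((1/2) *\<^sub>R ((1 - g) * (1 + g) + (1 + g)))"
    by (intro pos_scaleR pos_add[OF _ b(2)]) auto
  moreover have "(1 - g) * (1 + g) + (1 + g) = 2 *\<^sub>R 1 + g * (1 - g)"
    by (simp add: algebra_simps scaleR_2)
  then have "(1/2) *\<^sub>R ((1 - g) * (1 + g) + (1 + g)) = k"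
    by (simp add: k_def scaleR_add_right)
  ultimately have "pos k" by simp
  moreover have "h * g * k = k * (h * g)"
    by (simp only: mult.assoc gk) (simp only: mult.assoc[symmetric] hk)
  ultimately have "pos (h * g * k)" by (intro pos_mult[OF hg]) auto
  then show "pos (h * raise g)" by (simp add: rk mult.assoc)
qed

text \<open>The projection onto the positive part of \<open>h\<close>, as the limit \<open>p\<close> of the iterates of \<open>raise\<close>. Passing to
the limit in the recursion gives \<open>p\<^sup>2 = p\<^sup>3\<close>, and \<open>p\<close> is self-adjoint, so \<open>(p - p\<^sup>2)\<^sup>2 = 0\<close> and \<open>p\<close> is
a projection. The last two properties say that \<open>h \<ge> 0\<close> on the range of \<open>p\<close> and \<open>h \<le> p\<close>, so that
\<open>h \<le> 0\<close> on its kernel.\<close>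

lemma ex_spectral_projection:
  assumes h: "star h = h" "pos (1 - h)" "pos (1 + h)" "J h = h"
  shows "\<exists>p. star p = p \<and> p * p = p \<and> J p = p \<and> h * p = p * h \<and> pos (h * p) \<and> pos (p - h)"
proof -
  define g where "g n = (raise ^^ n) h" for n
  have g_Suc: "g (Suc n) = raise (g n)" for n by (simp add: g_def)
  have inv: "star (g n) = g n \<and> pos (1 - g n) \<and> pos (1 + g n) \<and> J (g n) = g n \<and>
      h * g n = g n * h \<and> pos (h * g n)" for n
  proof (induction n)
    case 0
    show ?case using h pos_square[OF h(1)] by (simp add: g_def)
  next
    case (Suc n)
    then show ?case unfolding g_Suc using raise_invariants[of "g n" h] by blast
  qed
  have mono: "pos (g (Suc n) - g n)" for n
    unfolding g_Suc using inv[of n] by (intro raise_invariants(7)[of "g n" h]) auto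
  obtain p where p: "star p = p" and lim: "\<And>\<xi>. (\<lambda>n. \<pi> (g n) \<xi>) \<longlonglongrightarrow> \<pi> p \<xi>"
    using monotone_strong_limit[of g] inv mono by blast
  have le: "pos (g (n + k) - g n)" for n k
  proof (induction k)
    case 0
    show ?case using pos_scaleR[OF pos_one, of 0] by simp
  next
    case (Suc k)
    show ?case using pos_add[OF mono[of "n + k"] Suc] by simp
  qed
  have upper: "pos (p - g n)" for n
  proof (rule pos_strong_limit[of "\<lambda>m. g m - g n"])
    show "(\<lambda>m. \<pi> (g m - g n) \<xi>) \<longlonglongrightarrow> \<pi> (p - g n) \<xi>" for \<xi>
      unfolding rep_diff blinfun.diff_left by (intro tendsto_intros lim)
    show "star (p - g n) = p - g n" using inv p by (simp add: star_diff)
    show "pos (g m - g n)" if "n \<le> m" for m using le[of n "m - n"] that by simp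
  qed
  have Jp: "J p = p"
    by (rule J_fixes_monotone_limit[of g p, OF lim p upper]) (use inv in blast)
  have hp: "h * p = p * h"
  proof (rule rep_eqI)
    fix \<xi>
    have "(\<lambda>n. \<pi> (h * g n) \<xi>) \<longlonglongrightarrow> \<pi> h (\<pi> p \<xi>)"
      unfolding rep_mult blinfun_apply_blinfun_compose by (intro tendsto_intros lim)
    moreover have "(\<lambda>n. \<pi> (h * g n) \<xi>) \<longlonglongrightarrow> \<pi> p (\<pi> h \<xi>)"
    proof -
      have "\<pi> (h * g n) \<xi> = \<pi> (g n) (\<pi> h \<xi>)" for n using inv[of n] by (simp add: rep_mult)
      then show ?thesis using lim by simp
    qed
    ultimately show "\<pi> (h * p) \<xi> = \<pi> (p * h) \<xi>"
      by (simp add: rep_mult LIMSEQ_unique)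
  qed
  have poshp: "pos (h * p)"
  proof (rule pos_strong_limit[of "\<lambda>n. h * g n"])
    show "(\<lambda>n. \<pi> (h * g n) \<xi>) \<longlonglongrightarrow> \<pi> (h * p) \<xi>" for \<xi>
      unfolding rep_mult blinfun_apply_blinfun_compose by (intro tendsto_intros lim)
    show "star (h * p) = h * p" by (simp add: star_mult h(1) p hp)
    show "pos (h * g n)" for n using inv by blast
  qed
  have bound: "norm (\<pi> (g n) \<xi>) \<le> norm \<xi>" for n \<xi>
    using inv by (intro norm_rep_le_one) auto
  have "p * p = p * p * p"
  proof (rule rep_eqI)
    fix \<xi>
    note ap = strong_limit_apply[of g p, OF lim bound]
    have l2: "(\<lambda>n. \<pi> (g n) (\<pi> (g n) \<xi>)) \<longlonglongrightarrow> \<pi> p (\<pi> p \<xi>)" by (rule ap[OF lim])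
    have l3: "(\<lambda>n. \<pi> (g n) (\<pi> (g n) (\<pi> (g n) \<xi>))) \<longlonglongrightarrow> \<pi> p (\<pi> p (\<pi> p \<xi>))" by (rule ap[OF l2])
    have "(\<lambda>n. 2 *\<^sub>R (\<pi> (g (Suc n)) \<xi> - \<pi> (g n) \<xi>)) \<longlonglongrightarrow> 2 *\<^sub>R (\<pi> p \<xi> - \<pi> p \<xi>)"
      by (intro tendsto_intros lim LIMSEQ_Suc[OF lim])
    moreover have "2 *\<^sub>R (\<pi> (g (Suc n)) \<xi> - \<pi> (g n) \<xi>) =
        \<pi> (g n) (\<pi> (g n) \<xi>) - \<pi> (g n) (\<pi> (g n) (\<pi> (g n) \<xi>))" for n
      by (simp add: g_Suc raise_def rep_simps right_diff_distrib)
    moreover have "(\<lambda>n. \<pi> (g n) (\<pi> (g n) \<xi>) - \<pi> (g n) (\<pi> (g n) (\<pi> (g n) \<xi>)))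
        \<longlonglongrightarrow> \<pi> p (\<pi> p \<xi>) - \<pi> p (\<pi> p (\<pi> p \<xi>))"
      by (intro tendsto_intros l2 l3)
    ultimately have "2 *\<^sub>R (\<pi> p \<xi> - \<pi> p \<xi>) = \<pi> p (\<pi> p \<xi>) - \<pi> p (\<pi> p (\<pi> p \<xi>))"
      using LIMSEQ_unique by (simp del: right_minus_eq diff_self)
    then show "\<pi> (p * p) \<xi> = \<pi> (p * p * p) \<xi>" by (simp add: rep_mult)
  qed
  then have "star (p - p * p) * (p - p * p) = 0"
    by (simp add: star_simps p algebra_simps)
  then have "p * p = p" using cstar_identity[of "p - p * p"] by simp
  then show ?thesis using p Jp hp poshp upper[of 0] by (auto simp: g_def)
qed

text \<open>For \<open>e = 2 p - 1\<close> the claim is \<open>-1 \<le> h - p \<le> 0\<close>. The lower bound is the positivity of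
\<open>1 + h - p = h p + (1 - p) (1 + h)\<close>.\<close>

lemma ex_symmetry:
  assumes h: "star h = h" "pos (1 - h)" "pos (1 + h)" "J h = h"
  shows "\<exists>e. star e = e \<and> e * e = 1 \<and> J e = e \<and> pos (1 - (2 *\<^sub>R h - e)) \<and> pos (1 + (2 *\<^sub>R h - e))"
proof -
  obtain p where p: "star p = p" "p * p = p" "J p = p" "h * p = p * h" "pos (h * p)" "pos (p - h)"
    using ex_spectral_projection[OF h] by blast
  define e where "e = 2 *\<^sub>R p - 1"
  have "star e = e" "e * e = 1" "J e = e"
    by (simp_all add: e_def star_simps J_simps p algebra_simps scaleR_2)
  moreover have "1 - (2 *\<^sub>R h - e) = 2 *\<^sub>R (p - h)" by (simp add: e_def scaleR_diff_right)
  then have "pos (1 - (2 *\<^sub>R h - e))" using pos_scaleR[OF p(6), of 2] by simp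
  moreover have "pos (1 + (2 *\<^sub>R h - e))"
  proof -
    have "pos ((1 - p) * (1 - p))" by (rule pos_square) (simp add: star_simps p)
    then have "pos (1 - p)" using p(2) by (simp add: algebra_simps)
    then have "pos ((1 - p) * (1 + h))"
      using h(3) by (intro pos_mult) (simp_all add: algebra_simps p(4))
    then have "pos (2 *\<^sub>R (h * p + (1 - p) * (1 + h)))"
      using p(5) by (intro pos_scaleR pos_add) auto
    moreover have "1 + (2 *\<^sub>R h - e) = 2 *\<^sub>R (h * p + (1 - p) * (1 + h))"
      by (simp add: e_def algebra_simps p(4) scaleR_2)
    ultimately show ?thesis by simp
  qed
  ultimately show ?thesis by blast
qed

text \<open>Binary expansion in symmetries: \<open>h = e / 2 + (2 h - e) / 2\<close>, where \<open>2 h - e\<close> satisfies the same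
hypotheses as \<open>h\<close> and enters with half the weight.\<close>

lemma self_adjoint_near_hull:
  assumes h: "star h = h" "pos (1 - h)" "pos (1 + h)" "J h = h"
  shows "\<exists>v\<in>convex hull {u. J u = u \<and> unitary u}. norm (h - v) \<le> 2 / 2 ^ n"
  using h
proof (induction n arbitrary: h)
  case 0
  have "norm (h - 1) \<le> 1 + 1"
    using norm_triangle_ineq4[of h 1] norm_one_le[where 'a='a] norm_le_one_of_order[OF 0(1-3)] by linarith
  moreover have "1 \<in> convex hull {u. J u = u \<and> unitary u}"
    by (intro hull_inc) (simp add: J_one unitary_def star_one)
  ultimately show ?case by (intro bexI[of _ 1]) auto
next
  case (Suc n)
  obtain e where e: "star e = e" "e * e = 1" "J e = e"
      "pos (1 - (2 *\<^sub>R h - e))" "pos (1 + (2 *\<^sub>R h - e))"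
    using ex_symmetry[OF Suc.prems] by blast
  obtain v where v: "v \<in> convex hull {u. J u = u \<and> unitary u}" "norm ((2 *\<^sub>R h - e) - v) \<le> 2 / 2 ^ n"
    using Suc.IH[OF _ e(4,5)] e(1,3) Suc.prems(1,4) by (auto simp: star_simps J_simps)
  have "e \<in> convex hull {u. J u = u \<and> unitary u}"
    using e by (intro hull_inc) (simp add: unitary_def)
  then have "(1/2) *\<^sub>R e + (1/2) *\<^sub>R v \<in> convex hull {u. J u = u \<and> unitary u}"
    using v(1) by (intro convexD[OF convex_convex_hull]) auto
  moreover have "h - ((1/2) *\<^sub>R e + (1/2) *\<^sub>R v) = (1/2) *\<^sub>R ((2 *\<^sub>R h - e) - v)"
    by (simp add: scaleR_diff_right)
  then have "norm (h - ((1/2) *\<^sub>R e + (1/2) *\<^sub>R v)) \<le> 2 / 2 ^ Suc n"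
    using v(2) by simp
  ultimately show ?case by blast
qed

lemma self_adjoint_in_closed_hull:
  assumes h: "star h = h" "norm h \<le> 1/2" "J h = h"
  shows "h \<in> closure (convex hull {u. J u = u \<and> unitary u})"
  unfolding closure_approachable
proof (intro allI impI)
  fix e :: real assume e: "0 < e"
  then obtain n where "2 / e < 2 ^ n" using real_arch_pow[of 2 "2 / e"] by auto
  then have n: "2 / 2 ^ n < e" using e by (simp add: field_simps)
  obtain v where "v \<in> convex hull {u. J u = u \<and> unitary u}" "norm (h - v) \<le> 2 / 2 ^ n"
    using self_adjoint_near_hull[OF h(1) order_of_norm_less_one h(3), of n] h by auto
  then show "\<exists>y\<in>convex hull {u. J u = u \<and> unitary u}. dist y h < e"
    using n by (intro bexI[of _ v]) (auto simp: dist_norm norm_minus_commute)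
qed

end

section \<open>Real von Neumann algebras\<close>

lemma conj_linear_star_automorphism_props:
  assumes J: "conj_linear_star_automorphism J"
  shows "J (x + y) = J x + J y" "J (c *\<^sub>C x) = cnj c *\<^sub>C J x" "J (x * y) = J x * J y"
    "J (star x) = star (J x)" "J (r *\<^sub>R x) = r *\<^sub>R J x" "J 1 = 1" "J (- x) = - J x"
proof -
  have c: "J (c *\<^sub>C x) = cnj c *\<^sub>C J x" and mult: "J (x * y) = J x * J y" for c x y
    using J by (auto simp: conj_linear_star_automorphism_def)
  show "J (x + y) = J x + J y" "J (star x) = star (J x)"
    using J by (auto simp: conj_linear_star_automorphism_def)
  have r: "J (r *\<^sub>R x) = r *\<^sub>R J x" for r x
    using c[of "complex_of_real r" x] by (simp add: scaleC_of_real)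
  obtain z where "J z = 1" using J by (metis conj_linear_star_automorphism_def bij_pointE)
  then show "J 1 = 1" using mult[of 1 z] by simp
  show "J (- x) = - J x" using r[of "-1" x] by simp
  show "J (c *\<^sub>C x) = cnj c *\<^sub>C J x" "J (x * y) = J x * J y" "J (r *\<^sub>R x) = r *\<^sub>R J x"
    by (rule c mult r)+
qed

text \<open>This provides continuity, and with it closedness of the set of fixed points. A skew-adjoint element
of norm \<open>1 / 2\<close> is half the difference of a unitary and its adjoint, and \<open>J\<close> maps unitaries to unitaries; the
self-adjoint part is reached through multiplication by \<open>\<i>\<close>.\<close>

lemma conj_linear_star_automorphism_bounded:
  assumes J: "conj_linear_star_automorphism J"
  shows "norm (J x) \<le> 4 * norm x"
proof -
  interpret closed_real_star_subalgebra "UNIV :: 'a set" by standard auto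
  note Jp = conj_linear_star_automorphism_props[OF J]
  have unit: "unitary (J u)" if "unitary u" for u
    using that Jp(6) by (simp add: unitary_def flip: Jp(3,4))
  have skew: "norm (J k) \<le> 2 * norm k" if k: "star k = - k" for k
  proof (cases "k = 0")
    case True then show ?thesis using Jp(5)[of 0 0] by simp
  next
    case False
    define k' where "k' = (1 / (2 * norm k)) *\<^sub>R k"
    have "\<exists>u\<in>UNIV. unitary u \<and> k' = (1/2) *\<^sub>R (u - star u)"
      using False by (intro skew_eq_unitary_difference) (auto simp: k'_def star_simps k)
    then obtain u where u: "unitary u" "k' = (1/2) *\<^sub>R (u - star u)" by blast
    have "J k' = (1/2) *\<^sub>R (J u - star (J u))"
      using Jp(1)[of u "- star u"] by (simp only: u(2) Jp(5)) (simp add: Jp(4,7))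
    then have "norm (J k') = (1/2) * norm (J u - star (J u))" by simp
    also have "\<dots> \<le> (1/2) * (1 + 1)"
      using norm_triangle_ineq4[of "J u" "star (J u)"] norm_unitary[OF unit[OF u(1)]] norm_star[of "J u"]
      by simp
    finally have "norm (J k') \<le> 1" by simp
    then show ?thesis using False by (simp add: k'_def Jp(5) divide_le_eq)
  qed
  define h k where "h = (1/2) *\<^sub>R (x + star x)" and "k = (1/2) *\<^sub>R (x - star x)"
  have n: "norm h \<le> norm x" "norm k \<le> norm x"
    using norm_triangle_ineq[of x "star x"] norm_triangle_ineq4[of x "star x"] norm_star[of x]
    by (simp_all add: h_def k_def)
  have "x = h + k" using scaleR_half_double[of x] by (simp add: h_def k_def algebra_simps)
  then have "norm (J x) \<le> norm (J h) + norm (J k)" by (metis Jp(1) norm_triangle_ineq)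
  also have "norm (J k) \<le> 2 * norm k"
    by (rule skew) (simp add: k_def star_simps flip: scaleR_minus_right)
  also have "norm (J h) = norm (J (\<i> *\<^sub>C h))" by (simp add: Jp(2) norm_scaleC)
  also have "\<dots> \<le> 2 * norm (\<i> *\<^sub>C h)"
    by (rule skew) (simp add: h_def star_simps scaleC_minus_left add.commute)
  also have "\<dots> = 2 * norm h" by (simp add: norm_scaleC)
  finally show ?thesis using n by linarith
qed

lemma extreme_directions_real_von_neumann:
  fixes A :: "'a::unital_cstar_algebra set"
  assumes "real_von_neumann_algebra TYPE('h::complex_hilbert_space) A"
  shows "\<exists>E. extreme_directions A E (1/4)"
proof -
  obtain J where J: "conj_linear_star_automorphism J" "J \<circ> J = id" and A: "A = {a. J a = a}"
    using assms by (auto simp: real_von_neumann_algebra_def real_cstar_algebra_def)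
  obtain \<pi> :: "'a \<Rightarrow> ('h \<Rightarrow>\<^sub>L 'h)" where \<pi>: "unital_star_representation \<pi>" "inj \<pi>"
      "closedin strong_operator_topology (range \<pi>)"
    using assms by (auto simp: real_von_neumann_algebra_def von_neumann_algebra_def)
  note Jp = conj_linear_star_automorphism_props[OF J(1)]
  interpret real_part_of_von_neumann_algebra \<pi> J
    by standard (use \<pi> Jp J(2) in \<open>auto simp: fun_eq_iff\<close>)
  have "bounded_linear J"
    by (rule bounded_linear_intro[of _ 4])
      (use Jp conj_linear_star_automorphism_bounded[OF J(1)] in \<open>auto simp: mult.commute\<close>)
  then have "closed A"
    unfolding A by (intro closed_Collect_eq continuous_intros) (rule bounded_linear.continuous_on, simp_all)
  interpret closed_real_star_subalgebra A
    by standard (use \<open>closed A\<close> J_scaleR[of 0 0] in \<open>auto simp: A subspace_def J_simps\<close>)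
  have "extreme_directions A {u \<in> A. unitary u} (1/4)"
    using self_adjoint_in_closed_hull by (intro extreme_directions_unitaries) (simp add: A)
  then show ?thesis by blast
qed

theorem corollary3:
  fixes A K :: "'a::unital_cstar_algebra set"
  assumes "A = UNIV \<or> real_von_neumann_algebra TYPE('h::complex_hilbert_space) A"
    and "convex_body_in A K"
  shows "strong_mankiewicz_property TYPE('y::real_normed_vector) K"
proof -
  obtain E where "extreme_directions A E (1/4)"
    using assms(1) extreme_directions_complex extreme_directions_real_von_neumann by blast
  then interpret extreme_directions A E "1/4" .
  show ?thesis by (rule strong_mankiewicz) fact
qed

end
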